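(* Let $k \in \mathbb{N}$ be a constant. Restricted to inputs consisting of an implicational base $\Sigma$ over $X$ and a consistency-graph $G_c = (X, E_c)$ such that the closure system $\mathcal{F}$ associated to $\Sigma$ has Carathéodory number $c(\mathcal{F}) \leq k$, the problem MCCEnum can be solved in incremental-polynomial time.
   Context: All objects are finite. An implication over a set $X$ is an expression $A \to B$ with $A, B \subseteq X$. An implicational base $\Sigma$ over $X$ is a set of implications over $X$. A set $F \subseteq X$ satisfies $\Sigma$ if for every $A \to B \in \Sigma$, $A \subseteq F$ implies $B \subseteq F$. The family $\mathcal{F}$ of all subsets of $X$ satisfying $\Sigma$ is a closure system (it contains $X$ and is closed under intersection); its members are called closed sets, and its closure operator is $\phi(Y) = \bigcap\{F \in \mathcal{F} \mid Y \subseteq F\}$. The Carathéodory number $c(\mathcal{F})$ is the least integer $k$ such that for all $A \subseteq X$ and $x \in X$, $x \in \phi(A)$ implies that there is $A' \subseteq A$ with $|A'| \leq k$ and $x \in \phi(A')$. A consistency-graph over $X$ is a (simple, undirected) graph $G_c = (X, E_c)$; it is non-empty if $E_c \neq \emptyset$. The set $\mathsf{maxCC}(\Sigma, G_c)$ consists of the inclusion-wise maximal members of $\{F \in \mathcal{F} \mid F \text{ is an independent set of } G_c\}$. Problem MCCEnum. Input: an implicational base $\Sigma$ over $X$ (with $X$ part of the input) and a non-empty consistency-graph $G_c = (X, E_c)$. Output: the set $\mathsf{maxCC}(\Sigma, G_c)$. An enumeration algorithm with input $x$ and set of solutions $R(x)$ runs in incremental-polynomial time if for every $1 \leq i \leq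 |R(x)|$ the time spent between the $i$-th and $(i+1)$-th output is bounded by a polynomial in $|x| + i$, and the algorithm stops in time polynomial in $|x|$ after the last output. *)

theory Defs
  imports Main "HOL-Computational_Algebra.Polynomial"
begin

section \<open>Implicational bases, closure systems and consistency-graphs\<close>

type_synonym 'a implication = "'a set \<times> 'a set"

definition implicational_base :: "'a set \<Rightarrow> 'a implication set \<Rightarrow> bool" where
  "implicational_base X \<Sigma> \<longleftrightarrow> (\<forall>(A, B) \<in> \<Sigma>. A \<subseteq> X \<and> B \<subseteq> X)"

definition satisfies :: "'a set \<Rightarrow> 'a implication set \<Rightarrow> bool" where
  "satisfies F \<Sigma> \<longleftrightarrow> (\<forall>(A, B) \<in> \<Sigma>. A \<subseteq> F \<longrightarrow> B \<subseteq> F)"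

definition closed_sets :: "'a set \<Rightarrow> 'a implication set \<Rightarrow> 'a set set" where
  "closed_sets X \<Sigma> = {F. F \<subseteq> X \<and> satisfies F \<Sigma>}"

definition closure_operator :: "'a set set \<Rightarrow> 'a set \<Rightarrow> 'a set" where
  "closure_operator \<F> Y = \<Inter> {F \<in> \<F>. Y \<subseteq> F}"

text \<open>
  Meant for finite \<open>X\<close>, where the bound \<open>card X\<close> always qualifies, so the minimum below exists.
\<close>

definition caratheodory_number :: "'a set \<Rightarrow> 'a set set \<Rightarrow> nat" where
  "caratheodory_number X \<F> =
     (LEAST k. \<forall>A x. A \<subseteq> X \<longrightarrow> x \<in> X \<longrightarrow> x \<in> closure_operator \<F> A \<longrightarrow>
        (\<exists>A'. A' \<subseteq> A \<and> card A' \<le> k \<and> x \<in> closure_operator \<F> A'))"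

definition simple_graph :: "'a set \<Rightarrow> 'a set set \<Rightarrow> bool" where
  "simple_graph X E \<longleftrightarrow> (\<forall>e \<in> E. e \<subseteq> X \<and> card e = 2)"

definition independent_set :: "'a set set \<Rightarrow> 'a set \<Rightarrow> bool" where
  "independent_set E F \<longleftrightarrow> (\<forall>u \<in> F. \<forall>v \<in> F. {u, v} \<notin> E)"

definition consistent_closed_sets ::
    "'a set \<Rightarrow> 'a implication set \<Rightarrow> 'a set set \<Rightarrow> 'a set set" where
  "consistent_closed_sets X \<Sigma> E = {F \<in> closed_sets X \<Sigma>. independent_set E F}"

definition maxCC :: "'a set \<Rightarrow> 'a implication set \<Rightarrow> 'a set set \<Rightarrow> 'a set set" where
  "maxCC X \<Sigma> E =
     {F \<in> consistent_closed_sets X \<Sigma> E. \<forall>G \<in> consistent_closed_sets X \<Sigma> E. F \<subseteq> G \<longrightarrow> G = F}"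


section \<open>Model of computation\<close>

text \<open>
  Programs are those of the WHILE language of N. D. Jones (Computability and Complexity from a
  Programming Perspective), extended by an output command: variables hold binary trees, which can
  only be built, taken apart, and compared with the empty tree. Time counts elementary operations.
  Since trees can be represented as shared pointer structures, each operation is a constant number
  of pointer manipulations, and polynomial time in this model is polynomial time on Turing
  machines. An output is charged for writing out the tree in full.
\<close>

datatype tree = Leaf | Node tree tree

primrec tree_size :: "tree \<Rightarrow> nat" where
  "tree_size Leaf = 1"
| "tree_size (Node l r) = Suc (tree_size l + tree_size r)"

primrec left :: "tree \<Rightarrow> tree" where
  "left Leaf = Leaf"
| "left (Node l r) = l"

primrec right :: "tree \<Rightarrow> tree" where
  "right Leaf = Leaf"
| "right (Node l r) = r"

datatype expr = Var nat | Empty | Cons expr expr | Hd expr | Tl expr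

datatype com =
    Assign nat expr
  | Seq com com
  | If expr com com
  | While expr com
  | Emit expr

type_synonym store = "nat \<Rightarrow> tree"

primrec eval_expr :: "expr \<Rightarrow> store \<Rightarrow> tree" where
  "eval_expr (Var x) s = s x"
| "eval_expr Empty s = Leaf"
| "eval_expr (Cons a b) s = Node (eval_expr a s) (eval_expr b s)"
| "eval_expr (Hd a) s = left (eval_expr a s)"
| "eval_expr (Tl a) s = right (eval_expr a s)"

primrec expr_cost :: "expr \<Rightarrow> nat" where
  "expr_cost (Var x) = 1"
| "expr_cost Empty = 1"
| "expr_cost (Cons a b) = Suc (expr_cost a + expr_cost b)"
| "expr_cost (Hd a) = Suc (expr_cost a)"
| "expr_cost (Tl a) = Suc (expr_cost a)"

text \<open>
  A configuration consists of the store, the clock, and the outputs produced so far, each with the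
  time at which it was completed. As a condition, \<open>Leaf\<close> means false.
\<close>

type_synonym config = "store \<times> nat \<times> (nat \<times> tree) list"

inductive exec :: "com \<Rightarrow> config \<Rightarrow> config \<Rightarrow> bool" where
  Assign: "exec (Assign x e) (s, t, os) (s(x := eval_expr e s), Suc (t + expr_cost e), os)"
| Seq: "exec c1 a b \<Longrightarrow> exec c2 b d \<Longrightarrow> exec (Seq c1 c2) a d"
| IfTrue: "eval_expr e s \<noteq> Leaf \<Longrightarrow> exec c1 (s, Suc (t + expr_cost e), os) d \<Longrightarrow>
    exec (If e c1 c2) (s, t, os) d"
| IfFalse: "eval_expr e s = Leaf \<Longrightarrow> exec c2 (s, Suc (t + expr_cost e), os) d \<Longrightarrow>
    exec (If e c1 c2) (s, t, os) d"
| WhileFalse: "eval_expr e s = Leaf \<Longrightarrow>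
    exec (While e c) (s, t, os) (s, Suc (t + expr_cost e), os)"
| WhileTrue: "eval_expr e s \<noteq> Leaf \<Longrightarrow> exec c (s, Suc (t + expr_cost e), os) b \<Longrightarrow>
    exec (While e c) b d \<Longrightarrow> exec (While e c) (s, t, os) d"
| Emit: "t' = Suc (t + expr_cost e + tree_size (eval_expr e s)) \<Longrightarrow>
    exec (Emit e) (s, t, os) (s, t', os @ [(t', eval_expr e s)])"

inductive_cases AssignE: "exec (Assign x e) (s, t, os) d"
inductive_cases SeqE: "exec (Seq c1 c2) a d"
inductive_cases IfE: "exec (If e c1 c2) (s, t, os) d"
inductive_cases WhileE: "exec (While e c) (s, t, os) d"
inductive_cases EmitE: "exec (Emit e) (s, t, os) d"

lemma exec_deterministic: "exec c a d \<Longrightarrow> exec c a d' \<Longrightarrow> d' = d"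
proof (induction arbitrary: d' rule: exec.induct)
  case Assign
  from Assign.prems show ?case by (rule AssignE)
next
  case Seq
  from Seq.prems show ?case by (rule SeqE) (use Seq.IH in blast)
next
  case IfTrue
  from IfTrue.prems show ?case by (rule IfE) (use IfTrue.hyps IfTrue.IH in blast)+
next
  case IfFalse
  from IfFalse.prems show ?case by (rule IfE) (use IfFalse.hyps IfFalse.IH in blast)+
next
  case WhileFalse
  from WhileFalse.prems show ?case by (rule WhileE) (use WhileFalse.hyps in blast)+
next
  case WhileTrue
  from WhileTrue.prems show ?case by (rule WhileE) (use WhileTrue.hyps WhileTrue.IH in blast)+
next
  case Emit
  from Emit.prems show ?case by (rule EmitE) (use Emit.hyps in simp)
qed

definition initial_config :: "tree \<Rightarrow> config" where
  "initial_config w = ((\<lambda>_. Leaf)(0 := w), 0, [])"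


section \<open>Enumeration in incremental-polynomial time\<close>

text \<open>
  For output times \<open>ts\<close> and halting time \<open>T\<close>: \<open>ts ! i\<close> is the time of output number \<open>i + 1\<close>, and
  \<open>(0 # ts) ! i\<close> that of output number \<open>i\<close>, or the start of the run if \<open>i = 0\<close>. If there is no
  output at all, the last condition bounds the whole running time.
\<close>

definition incremental_delays :: "nat poly \<Rightarrow> nat \<Rightarrow> nat list \<Rightarrow> nat \<Rightarrow> bool" where
  "incremental_delays p n ts T \<longleftrightarrow>
     (\<forall>i < length ts. ts ! i \<le> (0 # ts) ! i + poly p (n + i)) \<and>
     T \<le> last (0 # ts) + poly p n"

text \<open>
  An enumeration problem is given by the pairs of an input (as a tree) and its set of solutions
  (as trees).
\<close>

type_synonym enumeration_problem = "(tree \<times> tree set) set"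

definition incremental_polynomial_time :: "enumeration_problem \<Rightarrow> bool" where
  "incremental_polynomial_time P \<longleftrightarrow>
     (\<exists>(c :: com) (p :: nat poly). \<forall>(w, R) \<in> P. \<exists>s T os.
        exec c (initial_config w) (s, T, os) \<and>
        distinct (map snd os) \<and> set (map snd os) = R \<and>
        incremental_delays p (tree_size w) (map fst os) T)"


section \<open>The enumeration problem\<close>

primrec code_bool :: "bool \<Rightarrow> tree" where
  "code_bool False = Leaf"
| "code_bool True = Node Leaf Leaf"

primrec code_list :: "tree list \<Rightarrow> tree" where
  "code_list [] = Leaf"
| "code_list (x # xs) = Node x (code_list xs)"

text \<open>
  Subsets of \<open>X\<close> are coded as characteristic vectors with respect to a listing \<open>xs\<close> of \<open>X\<close>. As the
  input includes \<open>X\<close>, the resulting size is polynomially equivalent to that of coding sets as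
  lists of their elements. The names of the elements do not enter the code, so taking \<open>X\<close> to be a
  finite set of natural numbers is no restriction.
\<close>

definition code_set :: "'a list \<Rightarrow> 'a set \<Rightarrow> tree" where
  "code_set xs A = code_list (map (\<lambda>x. code_bool (x \<in> A)) xs)"

definition code_implication :: "'a list \<Rightarrow> 'a implication \<Rightarrow> tree" where
  "code_implication xs i = Node (code_set xs (fst i)) (code_set xs (snd i))"

definition code_input :: "'a list \<Rightarrow> 'a implication list \<Rightarrow> 'a set list \<Rightarrow> tree" where
  "code_input xs ims es =
     Node (code_set xs (set xs))
       (Node (code_list (map (code_implication xs) ims)) (code_list (map (code_set xs) es)))"

text \<open>
  The parameter \<open>C\<close> restricts the admissible inputs. Inputs occur with every listing of \<open>X\<close>, of
  the implications and of the edges.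
\<close>

definition MCCEnum ::
    "(nat set \<Rightarrow> nat implication set \<Rightarrow> nat set set \<Rightarrow> bool) \<Rightarrow> enumeration_problem" where
  "MCCEnum C =
     {(code_input xs ims es, code_set xs ` maxCC X \<Sigma> E) | X \<Sigma> E xs ims es.
        finite X \<and> implicational_base X \<Sigma> \<and> simple_graph X E \<and> E \<noteq> {} \<and> C X \<Sigma> E \<and>
        distinct xs \<and> set xs = X \<and> distinct ims \<and> set ims = \<Sigma> \<and> distinct es \<and> set es = E}"

end

theory Submission
  imports Defs
begin

text \<open>
  Let \<open>r = 2k\<close>. A set whose closure contains an edge has a subset of size at most \<open>r\<close> with the same
  property, \<open>k\<close> elements for each end of the edge. So the solutions are the maximal sets without
  such a subset. Suppose that some solutions \<open>S\<close> are known and that a solution \<open>F\<close> is missing, and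
  let \<open>Y\<close> be a minimal subset of \<open>F\<close> that is contained in no member of \<open>S\<close>. If \<open>Y\<close> has more than
  \<open>r + 1\<close> elements, choose \<open>W \<subseteq> Y\<close> of size \<open>r + 1\<close> and for every \<open>w \<in> W\<close> a solution \<open>G w\<close> in \<open>S\<close>
  that contains \<open>Y - {w}\<close>. Then \<open>(\<Inter>w\<in>W. G w) \<union> W\<close> contains \<open>Y\<close>, and its closure contains no edge,
  as each of its subsets of size at most \<open>r\<close> lies in some \<open>G w\<close>. Hence a set that leads to a new
  solution is found among the polynomially many sets \<open>W\<close> and \<open>(\<Inter>w\<in>W. G w) \<union> W\<close> with
  \<open>|W| \<le> r + 1\<close>, and it can be extended greedily.
\<close>

section \<open>Programs for polynomial-time functions\<close>

class encodable =
  fixes encode :: "'a \<Rightarrow> tree"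

instantiation bool :: encodable
begin
definition "encode = code_bool"
instance ..
end

instantiation prod :: (encodable, encodable) encodable
begin
definition "encode x = Node (encode (fst x)) (encode (snd x))"
instance ..
end

instantiation list :: (encodable) encodable
begin
definition "encode xs = code_list (map encode xs)"
instance ..
end

lemma encode_bool_simps [simp]: "encode False = Leaf" "encode True = Node Leaf Leaf"
  by (simp_all add: encode_bool_def)

lemma encode_bool_eq_Leaf_iff [simp]: "encode b = Leaf \<longleftrightarrow> \<not> b"
  by (cases b) simp_all

lemma encode_Pair [simp]: "encode (a, b) = Node (encode a) (encode b)"
  by (simp add: encode_prod_def)

lemma encode_Nil [simp]: "encode [] = Leaf"
  by (simp add: encode_list_def)

lemma encode_Cons [simp]: "encode (x # xs) = Node (encode x) (encode xs)"
  by (simp add: encode_list_def)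

abbreviation esize :: "'a::encodable \<Rightarrow> nat" where
  "esize x \<equiv> tree_size (encode x)"

text \<open>Of the terminal leaves of the two lists only one survives, hence the
  \<open>Suc\<close>.\<close>

lemma esize_append: "Suc (esize (xs @ ys)) = esize xs + esize ys"
  by (induction xs) auto

lemma esize_rev: "esize (rev xs) = esize xs"
proof (induction xs)
  case (Cons x xs)
  then show ?case using esize_append[of "rev xs" "[x]"] by simp
qed simp

lemma tree_size_ge_1: "1 \<le> tree_size t"
  by (cases t) auto

lemma length_le_esize: "length xs \<le> esize xs"
  by (induction xs) auto

lemma esize_mem_le: "x \<in> set xs \<Longrightarrow> esize x \<le> esize xs"
  by (induction xs) auto

lemma esize_list_le:
  assumes "\<And>x. x \<in> set xs \<Longrightarrow> esize x \<le> b"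
  shows "esize xs \<le> length xs * Suc b + 1"
  using assms by (induction xs) fastforce+

lemma esize_bool_le: "esize (b::bool) \<le> 3"
  by (cases b) simp_all

lemma esize_bool_list_le: "esize (v::bool list) \<le> 4 * length v + 1"
proof -
  have "esize v \<le> length v * Suc 3 + 1"
    by (intro esize_list_le esize_bool_le)
  then show ?thesis by (simp add: mult.commute)
qed

section \<open>Polynomial bounds in the size of the code\<close>

lemma poly_nat_mono:
  fixes p :: "nat poly"
  assumes "m \<le> n"
  shows "poly p m \<le> poly p n"
  using assms by (induction p) (auto intro: add_mono mult_mono)

named_theorems bound_intros

text \<open>Coefficients in \<open>nat\<close> make every such bound monotone
  (\<open>poly_nat_mono\<close>), so that sizes may be overestimated and bounds composed.\<close>

definition poly_bounded :: "('a::encodable \<Rightarrow> nat) \<Rightarrow> bool" where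
  "poly_bounded h \<longleftrightarrow> (\<exists>p::nat poly. \<forall>x. h x \<le> poly p (esize x))"

lemma poly_bounded_const [bound_intros]: "poly_bounded (\<lambda>_. c)"
  unfolding poly_bounded_def by (rule exI[of _ "[:c:]"]) simp

lemma poly_bounded_esize [bound_intros]: "poly_bounded esize"
  unfolding poly_bounded_def by (rule exI[of _ "[:0, 1:]"]) simp

lemma poly_bounded_add [bound_intros]:
  assumes "poly_bounded f" "poly_bounded g"
  shows "poly_bounded (\<lambda>x. f x + g x)"
proof -
  obtain p q :: "nat poly" where "\<forall>x. f x \<le> poly p (esize x)" "\<forall>x. g x \<le> poly q (esize x)"
    using assms unfolding poly_bounded_def by blast
  then have "\<forall>x. f x + g x \<le> poly (p + q) (esize x)"
    by (simp add: add_mono)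
  then show ?thesis unfolding poly_bounded_def by blast
qed

lemma poly_bounded_mult [bound_intros]:
  assumes "poly_bounded f" "poly_bounded g"
  shows "poly_bounded (\<lambda>x. f x * g x)"
proof -
  obtain p q :: "nat poly" where "\<forall>x. f x \<le> poly p (esize x)" "\<forall>x. g x \<le> poly q (esize x)"
    using assms unfolding poly_bounded_def by blast
  then have "\<forall>x. f x * g x \<le> poly (p * q) (esize x)"
    by (simp add: mult_mono)
  then show ?thesis unfolding poly_bounded_def by blast
qed

lemma poly_bounded_mono:
  assumes "poly_bounded g" "\<And>x. f x \<le> g x"
  shows "poly_bounded f"
  using assms unfolding poly_bounded_def by (meson order_trans)

lemma poly_bounded_Suc [bound_intros]: "poly_bounded f \<Longrightarrow> poly_bounded (\<lambda>x. Suc (f x))"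
  using poly_bounded_add[OF _ poly_bounded_const[of 1], of f] by simp

lemma poly_bounded_poly [bound_intros]:
  assumes "poly_bounded f"
  shows "poly_bounded (\<lambda>x. poly p (f x))"
proof -
  obtain q :: "nat poly" where "\<forall>x. f x \<le> poly q (esize x)"
    using assms unfolding poly_bounded_def by blast
  then have "\<forall>x. poly p (f x) \<le> poly (pcompose p q) (esize x)"
    by (simp add: poly_pcompose poly_nat_mono)
  then show ?thesis unfolding poly_bounded_def by blast
qed

lemma poly_bounded_comp:
  assumes "poly_bounded h" "poly_bounded (\<lambda>x. esize (f x))"
  shows "poly_bounded (\<lambda>x. h (f x))"
proof -
  obtain q :: "nat poly" where "\<forall>x. h x \<le> poly q (esize x)"
    using assms unfolding poly_bounded_def by blast
  then show ?thesis
    by (intro poly_bounded_mono[OF poly_bounded_poly[OF assms(2), of q]]) blast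
qed

text \<open>
  The calling convention: argument and result are passed in variable 0, and variable 1 holds a
  stack on which a program may save data, but which it has to restore. As trees can be shared,
  the running time does not bound the size of the result.
\<close>

definition computes :: "com \<Rightarrow> ('a::encodable \<Rightarrow> 'b::encodable) \<Rightarrow> ('a \<Rightarrow> nat) \<Rightarrow> bool" where
  "computes c f T \<longleftrightarrow> (\<forall>x s t os. s 0 = encode x \<longrightarrow>
     (\<exists>s' t'. exec c (s, t, os) (s', t', os) \<and> s' 0 = encode (f x) \<and> s' 1 = s 1 \<and> t' \<le> t + T x))"

definition ptime :: "('a::encodable \<Rightarrow> 'b::encodable) \<Rightarrow> bool" where
  "ptime f \<longleftrightarrow> poly_bounded (\<lambda>x. esize (f x)) \<and> (\<exists>c T. computes c f T \<and> poly_bounded T)"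

named_theorems ptime_intros

lemma computesE:
  assumes "computes c f T" "s 0 = encode x"
  obtains s' t' where "exec c (s, t, os) (s', t', os)" "s' 0 = encode (f x)" "s' 1 = s 1"
    "t' \<le> t + T x"
  using assms unfolding computes_def by blast

lemma ptimeE:
  assumes "ptime f"
  obtains c T where "computes c f T" "poly_bounded T" "poly_bounded (\<lambda>x. esize (f x))"
  using assms unfolding ptime_def by blast

lemma ptime_poly_bounded [bound_intros]: "ptime f \<Longrightarrow> poly_bounded (\<lambda>x. esize (f x))"
  unfolding ptime_def by blast

lemma ptimeI:
  assumes "computes c f T" "poly_bounded T" "poly_bounded (\<lambda>x. esize (f x))"
  shows "ptime f"
  using assms unfolding ptime_def by blast

section \<open>Elementary functions, composition and branching\<close>

lemma computes_expr:
  assumes "\<And>s x. s 0 = encode x \<Longrightarrow> eval_expr e s = encode (f x)"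
  shows "computes (Assign 0 e) f (\<lambda>_. Suc (expr_cost e))"
  unfolding computes_def
proof (intro allI impI)
  fix x :: 'a and s :: store and t os
  assume "s 0 = encode x"
  then show "\<exists>s' t'. exec (Assign 0 e) (s, t, os) (s', t', os) \<and> s' 0 = encode (f x) \<and>
      s' 1 = s 1 \<and> t' \<le> t + Suc (expr_cost e)"
    using exec.Assign[of 0 e s t os] assms[of s x] by fastforce
qed

text \<open>The cost of this expression depends on the fixed tree alone, which makes constants
  computable in constant time.\<close>

primrec quote :: "tree \<Rightarrow> expr" where
  "quote Leaf = Empty"
| "quote (Node l r) = Cons (quote l) (quote r)"

lemma eval_quote [simp]: "eval_expr (quote w) s = w"
  by (induction w) auto

lemma ptime_const [ptime_intros]: "ptime (\<lambda>_. c)"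
  by (rule ptimeI[OF computes_expr[of "quote (encode c)"]]) (auto intro: bound_intros)

lemma ptime_id [ptime_intros]: "ptime (\<lambda>x. x)"
  by (rule ptimeI[OF computes_expr[of "Var 0"]]) (auto intro: bound_intros)

text \<open>This is where \<open>ptime\<close> needs its size bound: the cost of \<open>g\<close> is
  polynomial in the size of \<open>f x\<close>, which the running time of \<open>f\<close> does not
  control.\<close>

lemma ptime_comp:
  assumes "ptime f" "ptime g"
  shows "ptime (\<lambda>x. g (f x))"
proof -
  obtain c T where f: "computes c f T" "poly_bounded T" "poly_bounded (\<lambda>x. esize (f x))"
    by (rule ptimeE[OF assms(1)])
  obtain d U where g: "computes d g U" "poly_bounded U" "poly_bounded (\<lambda>x. esize (g x))"
    by (rule ptimeE[OF assms(2)])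
  have "computes (Seq c d) (\<lambda>x. g (f x)) (\<lambda>x. T x + U (f x))"
    unfolding computes_def
  proof (intro allI impI)
    fix x :: 'a and s :: store and t os
    assume "s 0 = encode x"
    then obtain s1 t1 where 1: "exec c (s, t, os) (s1, t1, os)" "s1 0 = encode (f x)" "s1 1 = s 1"
      "t1 \<le> t + T x"
      using computesE[OF f(1), where s = s] by blast
    obtain s2 t2 where 2: "exec d (s1, t1, os) (s2, t2, os)" "s2 0 = encode (g (f x))"
      "s2 1 = s1 1" "t2 \<le> t1 + U (f x)"
      using computesE[OF g(1), where s = s1] 1(2) by blast
    show "\<exists>s' t'. exec (Seq c d) (s, t, os) (s', t', os) \<and> s' 0 = encode (g (f x)) \<and>
        s' 1 = s 1 \<and> t' \<le> t + (T x + U (f x))"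
      by (rule exI[of _ s2], rule exI[of _ t2]) (use 1 2 in \<open>auto intro: exec.Seq\<close>)
  qed
  then show ?thesis
    by (rule ptimeI) (intro poly_bounded_add f poly_bounded_comp[OF g(2) f(3)]
        poly_bounded_comp[OF g(3) f(3)])+
qed

lemma ptime_expr:
  assumes "\<And>s x. s 0 = encode x \<Longrightarrow> eval_expr e s = encode (f x)" "\<And>x. esize (f x) \<le> esize x"
  shows "ptime f"
  by (rule ptimeI[OF computes_expr[of e]])
    (use assms(1) poly_bounded_mono[OF poly_bounded_esize assms(2)] in \<open>auto intro: bound_intros\<close>)

lemma ptime_fst [ptime_intros]: "ptime f \<Longrightarrow> ptime (\<lambda>x. fst (f x))"
  by (erule ptime_comp) (rule ptime_expr[of "Hd (Var 0)"], auto simp: encode_prod_def)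

lemma ptime_snd [ptime_intros]: "ptime f \<Longrightarrow> ptime (\<lambda>x. snd (f x))"
  by (erule ptime_comp) (rule ptime_expr[of "Tl (Var 0)"], auto simp: encode_prod_def)

lemma exec_Assign_Seq:
  assumes "exec c (s(x := eval_expr e s), Suc (t + expr_cost e), os) d"
  shows "exec (Seq (Assign x e) c) (s, t, os) d"
  by (rule exec.Seq[OF exec.Assign assms])

lemma ptime_Pair [ptime_intros]:
  assumes "ptime f" "ptime g"
  shows "ptime (\<lambda>x. (f x, g x))"
proof -
  obtain c T where f: "computes c f T" "poly_bounded T" "poly_bounded (\<lambda>x. esize (f x))"
    by (rule ptimeE[OF assms(1)])
  obtain d U where g: "computes d g U" "poly_bounded U" "poly_bounded (\<lambda>x. esize (g x))"
    by (rule ptimeE[OF assms(2)])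
  \<comment> \<open>\<open>c1\<close> saves the argument on the stack and computes \<open>f\<close>;
    \<open>c2\<close> stores the result just below the argument, reloads the argument and computes
    \<open>g\<close>; \<open>c3\<close> pairs the two results and pops both saved trees.\<close>
  define c1 where "c1 = Seq (Assign 1 (Cons (Var 0) (Var 1))) c"
  define c2 where "c2 = Seq (Assign 1 (Cons (Hd (Var 1)) (Cons (Var 0) (Tl (Var 1)))))
    (Seq (Assign 0 (Hd (Var 1))) d)"
  define c3 where "c3 = Seq (Assign 0 (Cons (Hd (Tl (Var 1))) (Var 0))) (Assign 1 (Tl (Tl (Var 1))))"
  \<comment> \<open>Apart from \<open>c\<close> and \<open>d\<close> the assignments take 4, 11 and
    10 units, so 26 suffices.\<close>
  have "computes (Seq c1 (Seq c2 c3)) (\<lambda>x. (f x, g x)) (\<lambda>x. T x + U x + 26)"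
    unfolding computes_def
  proof (intro allI impI)
    fix x :: 'a and s :: store and t os
    assume s: "s 0 = encode x"
    let ?s = "s(1 := Node (encode x) (s 1))"
    have s0: "?s 0 = encode x" using s by simp
    obtain s1 t1 where 1: "exec c (?s, t + 4, os) (s1, t1, os)" "s1 0 = encode (f x)" "s1 1 = ?s 1"
      "t1 \<le> t + 4 + T x"
      by (rule computesE[where s = ?s, OF f(1) s0])
    have e1: "exec c1 (s, t, os) (s1, t1, os)"
      unfolding c1_def by (rule exec_Assign_Seq) (use 1 s in \<open>simp add: eval_nat_numeral\<close>)
    let ?s1 = "s1(1 := Node (encode x) (Node (encode (f x)) (s 1)), 0 := encode x)"
    have s1: "?s1 0 = encode x" by simp
    obtain s2 t2 where 2: "exec d (?s1, t1 + 11, os) (s2, t2, os)" "s2 0 = encode (g x)"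
      "s2 1 = ?s1 1" "t2 \<le> t1 + 11 + U x"
      by (rule computesE[where s = ?s1, OF g(1) s1])
    have e2: "exec c2 (s1, t1, os) (s2, t2, os)"
      unfolding c2_def using 1 2 by (intro exec_Assign_Seq) (simp add: fun_upd_def eval_nat_numeral cong: if_cong)
    let ?s3 = "s2(0 := Node (encode (f x)) (encode (g x)), 1 := s 1)"
    have e3: "exec c3 (s2, t2, os) (?s3, t2 + 10, os)"
      unfolding c3_def
      by (rule exec_Assign_Seq)
        (use 2 exec.Assign[of 1 "Tl (Tl (Var 1))" "s2(0 := Node (encode (f x)) (encode (g x)))" "t2 + 6" os] in \<open>simp add: eval_nat_numeral\<close>)
    show "\<exists>s' t'. exec (Seq c1 (Seq c2 c3)) (s, t, os) (s', t', os) \<and> s' 0 = encode (f x, g x) \<and>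
        s' 1 = s 1 \<and> t' \<le> t + (T x + U x + 26)"
      by (rule exI[of _ ?s3], rule exI[of _ "t2 + 10"])
        (use 1(4) 2(4) exec.Seq[OF e1 exec.Seq[OF e2 e3]] in simp)
  qed
  moreover have "poly_bounded (\<lambda>x. esize (f x, g x))"
    using f(3) g(3) by (auto intro!: bound_intros)
  moreover have "poly_bounded (\<lambda>x. T x + U x + 26)"
    by (intro bound_intros f(2) g(2))
  ultimately show ?thesis by (intro ptimeI)
qed

text \<open>Programs see values only through their codes, so even the result type may
  change.\<close>

lemma ptime_encode_cong:
  assumes "ptime f" "\<And>x. encode (f x) = encode (g x)"
  shows "ptime g"
  using assms unfolding ptime_def computes_def by simp

text \<open>A nonempty list has the same code as the pair of its head and its tail.\<close>

lemma ptime_Cons [ptime_intros]: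
  assumes "ptime f" "ptime g"
  shows "ptime (\<lambda>x. f x # g x)"
  by (rule ptime_encode_cong[OF ptime_Pair[OF assms]]) simp

lemma ptime_case_list [ptime_intros]:
  assumes "ptime l" "ptime f" "ptime (\<lambda>z. g (fst z) (fst (snd z)) (snd (snd z)))"
  shows "ptime (\<lambda>x. case l x of [] \<Rightarrow> f x | y # ys \<Rightarrow> g x y ys)"
proof -
  let ?g = "\<lambda>z. g (fst z) (fst (snd z)) (snd (snd z))"
  let ?h = "\<lambda>(x, l). case l of [] \<Rightarrow> f x | y # ys \<Rightarrow> g x y ys"
  obtain c T where f: "computes c f T" "poly_bounded T" "poly_bounded (\<lambda>x. esize (f x))"
    by (rule ptimeE[OF assms(2)])
  obtain d U where g: "computes d ?g U" "poly_bounded U" "poly_bounded (\<lambda>x. esize (?g x))"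
    by (rule ptimeE[OF assms(3)])
  \<comment> \<open>The two branches run on \<open>x\<close> and on a triple. Polynomial bounds can
    both be raised to the size of the pair \<open>z\<close>, which gives one bound for either
    branch.\<close>
  obtain p where p: "\<And>x. T x \<le> poly p (esize x)"
    using f(2) unfolding poly_bounded_def by blast
  obtain q where q: "\<And>z. U z \<le> poly q (esize z)"
    using g(2) unfolding poly_bounded_def by blast
  obtain p' where p': "\<And>x. esize (f x) \<le> poly p' (esize x)"
    using f(3) unfolding poly_bounded_def by blast
  obtain q' where q': "\<And>z. esize (?g z) \<le> poly q' (esize z)"
    using g(3) unfolding poly_bounded_def by blast
  define V :: "'a \<times> 'b list \<Rightarrow> nat" where "V z = poly p (esize z) + poly q (esize z) + 7" for z
  \<comment> \<open>For a nonempty list the code of \<open>(x, y # ys)\<close> is already that of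
    \<open>(x, y, ys)\<close>, so \<open>d\<close> can start at once; otherwise the empty list is
    dropped before \<open>c\<close>.\<close>
  let ?c = "If (Tl (Var 0)) d (Seq (Assign 0 (Hd (Var 0))) c)"
  have "computes ?c ?h V"
    unfolding computes_def
  proof (intro allI impI)
    fix z :: "'a \<times> 'b list" and s :: store and t os
    assume s: "s 0 = encode z"
    obtain x l where z: "z = (x, l)" by (cases z)
    show "\<exists>s' t'. exec ?c (s, t, os) (s', t', os) \<and> s' 0 = encode (?h z) \<and> s' 1 = s 1 \<and> t' \<le> t + V z"
    proof (cases l)
      case Nil
      let ?s = "s(0 := encode x)"
      have s0: "?s 0 = encode x" by simp
      obtain s1 t1 where 1: "exec c (?s, t + 6, os) (s1, t1, os)" "s1 0 = encode (f x)" "s1 1 = ?s 1"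
        "t1 \<le> t + 6 + T x"
        by (rule computesE[where s = ?s, OF f(1) s0])
      have "exec ?c (s, t, os) (s1, t1, os)"
        by (rule exec.IfFalse, use s z Nil in simp, rule exec_Assign_Seq) (use 1 s z Nil in \<open>simp add: eval_nat_numeral\<close>)
      moreover have "t1 \<le> t + V z"
        using 1(4) p[of x] poly_nat_mono[of "esize x" "esize z" p] unfolding V_def z by simp
      ultimately show ?thesis using 1 z Nil by auto
    next
      case (Cons y ys)
      have s0: "s 0 = encode (x, y, ys)" using s z Cons by simp
      obtain s1 t1 where 1: "exec d (s, t + 3, os) (s1, t1, os)" "s1 0 = encode (?g (x, y, ys))" "s1 1 = s 1"
        "t1 \<le> t + 3 + U (x, y, ys)"
        by (rule computesE[where s = s, OF g(1) s0])
      have "exec ?c (s, t, os) (s1, t1, os)"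
        by (rule exec.IfTrue, use s z Cons in simp) (use 1 s z Cons in \<open>simp add: eval_nat_numeral\<close>)
      moreover have "t1 \<le> t + V z"
        using 1(4) q[of "(x, y, ys)"] unfolding V_def z Cons by simp
      ultimately show ?thesis using 1 z Cons by auto
    qed
  qed
  moreover have "poly_bounded V"
    unfolding V_def by (intro bound_intros)
  moreover have "poly_bounded (\<lambda>z. esize (?h z))"
  proof (rule poly_bounded_mono)
    show "poly_bounded (\<lambda>z::'a \<times> 'b list. poly p' (esize z) + poly q' (esize z))"
      by (intro bound_intros)
    fix z :: "'a \<times> 'b list"
    obtain x l where z: "z = (x, l)" by (cases z)
    show "esize (?h z) \<le> poly p' (esize z) + poly q' (esize z)"
    proof (cases l)
      case Nil
      then show ?thesis using p'[of x] poly_nat_mono[of "esize x" "esize z" p'] z by simp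
    next
      case (Cons y ys)
      then show ?thesis using q'[of "(x, y, ys)"] z by simp
    qed
  qed
  ultimately have "ptime ?h" by (intro ptimeI)
  from ptime_comp[OF ptime_Pair[OF ptime_id assms(1)] this] show ?thesis by simp
qed

lemma ptime_If [ptime_intros]:
  assumes "ptime b" "ptime f" "ptime g"
  shows "ptime (\<lambda>x. if b x then f x else g x)"
proof -
  \<comment> \<open>\<open>True\<close> and \<open>[[]]\<close> share the code
    \<open>Node Leaf Leaf\<close>, and \<open>False\<close> and \<open>[]\<close> the code
    \<open>Leaf\<close>; thus a test is a case distinction on lists.\<close>
  have l: "ptime (\<lambda>x. if b x then [[]::bool list] else [])"
    by (rule ptime_encode_cong[OF assms(1)]) simp
  have "ptime (\<lambda>x. case if b x then [[]::bool list] else [] of [] \<Rightarrow> g x | y # ys \<Rightarrow> f x)"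
    by (intro ptime_case_list l assms(3) ptime_comp[OF _ assms(2)] ptime_fst ptime_id)
  moreover have "(\<lambda>x. case if b x then [[]::bool list] else [] of [] \<Rightarrow> g x | y # ys \<Rightarrow> f x)
      = (\<lambda>x. if b x then f x else g x)"
    by auto
  ultimately show ?thesis by simp
qed

lemma ptime_not [ptime_intros]:
  assumes "ptime b"
  shows "ptime (\<lambda>x. \<not> b x)"
proof -
  have "(\<lambda>x. \<not> b x) = (\<lambda>x. if b x then False else True)" by auto
  then show ?thesis using ptime_If[OF assms ptime_const[of False] ptime_const[of True]] by argo
qed

lemma ptime_conj [ptime_intros]:
  assumes "ptime a" "ptime b"
  shows "ptime (\<lambda>x. a x \<and> b x)"
proof -
  have "(\<lambda>x. a x \<and> b x) = (\<lambda>x. if a x then b x else False)" by auto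
  then show ?thesis using ptime_If[OF assms ptime_const[of False]] by argo
qed

lemma ptime_disj [ptime_intros]:
  assumes "ptime a" "ptime b"
  shows "ptime (\<lambda>x. a x \<or> b x)"
proof -
  have "(\<lambda>x. a x \<or> b x) = (\<lambda>x. if a x then True else b x)" by auto
  then show ?thesis using ptime_If[OF assms(1) ptime_const[of True] assms(2)] by argo
qed

lemma ptime_imp [ptime_intros]:
  assumes "ptime a" "ptime b"
  shows "ptime (\<lambda>x. a x \<longrightarrow> b x)"
proof -
  have "(\<lambda>x. a x \<longrightarrow> b x) = (\<lambda>x. if a x then b x else True)" by auto
  then show ?thesis using ptime_If[OF assms ptime_const[of True]] by argo
qed

text \<open>Polynomial growth in each single round can compound to exponential growth over a loop.
  Therefore a bound \<open>h\<close> on the accumulator is required after every prefix of the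
  list.\<close>

lemma ptime_foldl:
  fixes l :: "'a::encodable \<Rightarrow> 'b::encodable list" and i :: "'a \<Rightarrow> 'c::encodable"
  assumes l: "ptime l" and i: "ptime i"
    and g: "ptime (\<lambda>z. g (fst z) (fst (snd z)) (snd (snd z)))"
    and h: "poly_bounded h" "\<And>x ys zs. l x = ys @ zs \<Longrightarrow> esize (foldl (g x) (i x) ys) \<le> h x"
  shows "ptime (\<lambda>x. foldl (g x) (i x) (l x))"
proof -
  let ?g = "\<lambda>z. g (fst z) (fst (snd z)) (snd (snd z))"
  obtain d U where d: "computes d ?g U" "poly_bounded U" "poly_bounded (\<lambda>x. esize (?g x))"
    by (rule ptimeE[OF g])
  obtain q where q: "\<And>z. U z \<le> poly q (esize z)"
    using d(2) unfolding poly_bounded_def by blast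
  \<comment> \<open>The loop state in variable 0 is the triple of \<open>x\<close>, the accumulator
    and the remaining list. It is saved on the stack and cut down to the argument of
    \<open>d\<close>; afterwards the new state is assembled from the result and the saved
    copy.\<close>
  define body where "body = Seq (Assign 1 (Cons (Var 0) (Var 1)))
    (Seq (Assign 0 (Cons (Hd (Var 0)) (Cons (Hd (Tl (Var 0))) (Hd (Tl (Tl (Var 0)))))))
    (Seq d
    (Seq (Assign 0 (Cons (Hd (Hd (Var 1))) (Cons (Var 0) (Tl (Tl (Tl (Hd (Var 1))))))))
    (Assign 1 (Tl (Var 1))))))"
  have body: "\<exists>s' t'. exec body (s, t, os) (s', t', os) \<and> s' 0 = encode (x, g x a y, ys) \<and>
      s' 1 = s 1 \<and> t' \<le> t + 31 + U (x, a, y)"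
    if s: "s 0 = encode (x, a, y # ys)" for s t os x a y ys
  proof -
    let ?s = "s(1 := Node (s 0) (s 1), 0 := encode (x, a, y))"
    have s0: "?s 0 = encode (x, a, y)" by simp
    obtain s1 t1 where 1: "exec d (?s, t + 16, os) (s1, t1, os)" "s1 0 = encode (?g (x, a, y))"
      "s1 1 = ?s 1" "t1 \<le> t + 16 + U (x, a, y)"
      by (rule computesE[where s = ?s, OF d(1) s0])
    let ?s2 = "s1(0 := encode (x, g x a y, ys))"
    let ?s3 = "?s2(1 := s 1)"
    have e2: "exec (Assign 0 (Cons (Hd (Hd (Var 1))) (Cons (Var 0) (Tl (Tl (Tl (Hd (Var 1))))))))
      (s1, t1, os) (?s2, t1 + 12, os)"
      using exec.Assign[of 0 "Cons (Hd (Hd (Var 1))) (Cons (Var 0) (Tl (Tl (Tl (Hd (Var 1))))))" s1 t1 os] 1 s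
      by (simp add: eval_nat_numeral)
    have e3: "exec (Assign 1 (Tl (Var 1))) (?s2, t1 + 12, os) (?s3, t1 + 15, os)"
      using exec.Assign[of 1 "Tl (Var 1)" ?s2 "t1 + 12" os] 1 s by (simp add: eval_nat_numeral)
    have "exec body (s, t, os) (?s3, t1 + 15, os)"
      unfolding body_def
      by (rule exec_Assign_Seq, rule exec_Assign_Seq, rule exec.Seq[OF _ exec.Seq[OF e2 e3]])
        (use s 1 in \<open>simp add: eval_nat_numeral\<close>)
    then show ?thesis
      using 1(4) by (intro exI[of _ ?s3] exI[of _ "t1 + 15"]) simp
  qed
  let ?loop = "While (Tl (Tl (Var 0))) body"
  \<comment> \<open>\<open>b\<close> bounds all later accumulators and \<open>m\<close> the list
    entries. A round costs 4 for the test and 31 for the body besides \<open>d\<close>; the 2 inside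
    the polynomial counts the nodes of the triple, and the single 4 pays for the last, failing
    test.\<close>
  have loop: "\<exists>s' t'. exec ?loop (s, t, os) (s', t', os) \<and>
      s' 0 = encode (x, foldl (g x) a ys, [] :: 'b list) \<and>
      s' 1 = s 1 \<and> t' \<le> t + 4 + length ys * (35 + poly q (esize x + b + m + 2))"
    if s: "s 0 = encode (x, a, ys)"
      and b: "\<And>us vs. ys = us @ vs \<Longrightarrow> esize (foldl (g x) a us) \<le> b"
      and m: "\<And>y. y \<in> set ys \<Longrightarrow> esize y \<le> m"
    for s t os x a ys b m
    using that
  proof (induction ys arbitrary: s t a)
    case Nil
    have "exec ?loop (s, t, os) (s, Suc (t + expr_cost (Tl (Tl (Var 0)))), os)"
      by (rule exec.WhileFalse) (use Nil in simp)
    then show ?case using Nil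
      by (intro exI[of _ s] exI[of _ "t + 4"]) (simp add: eval_nat_numeral)
  next
    case (Cons y ys)
    obtain s1 t1 where 1: "exec body (s, t + 4, os) (s1, t1, os)" "s1 0 = encode (x, g x a y, ys)"
      "s1 1 = s 1" "t1 \<le> t + 4 + 31 + U (x, a, y)"
      using body[where s = s and t = "t + 4" and os = os, OF Cons.prems(1)] by blast
    have b': "esize (foldl (g x) (g x a y) us) \<le> b" if "ys = us @ vs" for us vs
      using Cons.prems(2)[of "y # us" vs] that by simp
    have "\<exists>s2 t2. exec ?loop (s1, t1, os) (s2, t2, os) \<and>
        s2 0 = encode (x, foldl (g x) (g x a y) ys, [] :: 'b list) \<and>
        s2 1 = s1 1 \<and> t2 \<le> t1 + 4 + length ys * (35 + poly q (esize x + b + m + 2))"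
      by (rule Cons.IH[where s = s1 and a = "g x a y", OF 1(2)]) (use b' Cons.prems(3) in auto)
    then obtain s2 t2 where 2: "exec ?loop (s1, t1, os) (s2, t2, os)"
      "s2 0 = encode (x, foldl (g x) (g x a y) ys, [] :: 'b list)" "s2 1 = s1 1"
      "t2 \<le> t1 + 4 + length ys * (35 + poly q (esize x + b + m + 2))"
      by blast
    have "U (x, a, y) \<le> poly q (esize (x, a, y))" by (rule q)
    also have "\<dots> \<le> poly q (esize x + b + m + 2)"
      by (rule poly_nat_mono)
        (use Cons.prems(2)[of "[]" "y # ys"] Cons.prems(3)[of y] in simp)
    finally have U: "U (x, a, y) \<le> poly q (esize x + b + m + 2)" .
    have "exec ?loop (s, t, os) (s2, t2, os)"
      by (rule exec.WhileTrue[OF _ _ 2(1)]) (use 1 Cons.prems(1) in \<open>simp_all add: eval_nat_numeral\<close>)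
    then show ?case
      using 1 2 U by (intro exI[of _ s2] exI[of _ t2]) (simp add: algebra_simps)
  qed
  have "ptime (\<lambda>x. (x, i x, l x))"
    by (intro ptime_intros l i)
  then obtain c T where c: "computes c (\<lambda>x. (x, i x, l x)) T" "poly_bounded T"
    by (rule ptimeE)
  \<comment> \<open>The 8 consists of the failing test and the extraction of the accumulator, 4
    units each; \<open>esize (l x)\<close> plays the role of \<open>m\<close>.\<close>
  define V where "V x = T x + length (l x) * (35 + poly q (esize x + h x + esize (l x) + 2)) + 8" for x
  have "computes (Seq c (Seq ?loop (Assign 0 (Hd (Tl (Var 0)))))) (\<lambda>x. foldl (g x) (i x) (l x)) V"
    unfolding computes_def
  proof (intro allI impI)
    fix x :: 'a and s :: store and t os
    assume s: "s 0 = encode x"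
    obtain s1 t1 where 1: "exec c (s, t, os) (s1, t1, os)" "s1 0 = encode (x, i x, l x)"
      "s1 1 = s 1" "t1 \<le> t + T x"
      by (rule computesE[where s = s, OF c(1) s])
    have "\<exists>s2 t2. exec ?loop (s1, t1, os) (s2, t2, os) \<and>
        s2 0 = encode (x, foldl (g x) (i x) (l x), [] :: 'b list) \<and> s2 1 = s1 1 \<and>
        t2 \<le> t1 + 4 + length (l x) * (35 + poly q (esize x + h x + esize (l x) + 2))"
      by (rule loop[where s = s1 and a = "i x", OF 1(2)]) (use h(2) esize_mem_le in blast)+
    then obtain s2 t2 where 2: "exec ?loop (s1, t1, os) (s2, t2, os)"
      "s2 0 = encode (x, foldl (g x) (i x) (l x), [] :: 'b list)" "s2 1 = s1 1"
      "t2 \<le> t1 + 4 + length (l x) * (35 + poly q (esize x + h x + esize (l x) + 2))"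
      by blast
    let ?s3 = "s2(0 := encode (foldl (g x) (i x) (l x)))"
    have 3: "exec (Assign 0 (Hd (Tl (Var 0)))) (s2, t2, os) (?s3, t2 + 4, os)"
      using exec.Assign[of 0 "Hd (Tl (Var 0))" s2 t2 os] 2(2) by (simp add: eval_nat_numeral)
    show "\<exists>s' t'. exec (Seq c (Seq ?loop (Assign 0 (Hd (Tl (Var 0)))))) (s, t, os) (s', t', os) \<and>
        s' 0 = encode (foldl (g x) (i x) (l x)) \<and> s' 1 = s 1 \<and> t' \<le> t + V x"
      using 1 2 3 exec.Seq[OF 1(1) exec.Seq[OF 2(1) 3]] unfolding V_def
      by (intro exI[of _ ?s3] exI[of _ "t2 + 4"]) simp
  qed
  moreover have "poly_bounded V"
    unfolding V_def
    by (intro bound_intros c(2) h(1) l poly_bounded_mono[OF ptime_poly_bounded[OF l] length_le_esize])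
  moreover have "poly_bounded (\<lambda>x. esize (foldl (g x) (i x) (l x)))"
    by (rule poly_bounded_mono[OF h(1) h(2)]) simp
  ultimately show ?thesis by (intro ptimeI)
qed

lemma ptime_comp2:
  assumes "ptime (\<lambda>z. g (fst z) (snd z))" "ptime a" "ptime b"
  shows "ptime (\<lambda>x. g (a x) (b x))"
  using ptime_comp[OF ptime_Pair[OF assms(2,3)] assms(1)] by simp

lemma foldl_Cons_eq: "foldl (\<lambda>a y. y # a) ys xs = rev xs @ ys"
  by (induction xs arbitrary: ys) auto

text \<open>Pushing entries one at a time reverses them. Both \<open>rev\<close> and, by reversing
  twice, append are obtained from this fold.\<close>

lemma ptime_rev_append:
  assumes "ptime f" "ptime g"
  shows "ptime (\<lambda>x. rev (f x) @ g x)"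
proof -
  have "ptime (\<lambda>x. foldl (\<lambda>a y. y # a) (g x) (f x))"
  proof (rule ptime_foldl)
    show "poly_bounded (\<lambda>x. esize (f x) + esize (g x))"
      by (intro bound_intros assms)
    fix x ys zs assume *: "f x = ys @ zs"
    show "esize (foldl (\<lambda>a y. y # a) (g x) ys) \<le> esize (f x) + esize (g x)"
      using esize_append[of "rev ys" "g x"] esize_append[of ys zs] esize_rev[of ys] tree_size_ge_1[of "encode zs"]
      by (simp add: foldl_Cons_eq *)
  qed (intro ptime_intros assms)+
  then show ?thesis by (simp add: foldl_Cons_eq)
qed

lemma ptime_rev [ptime_intros]: "ptime f \<Longrightarrow> ptime (\<lambda>x. rev (f x))"
  using ptime_rev_append[of f "\<lambda>_. []"] by (simp add: ptime_const)

lemma ptime_append [ptime_intros]: "ptime f \<Longrightarrow> ptime g \<Longrightarrow> ptime (\<lambda>x. f x @ g x)"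
  using ptime_rev_append[of "\<lambda>x. rev (f x)" g] by (simp add: ptime_rev)

lemma ptime_bind:
  assumes l: "ptime l" and g: "ptime (\<lambda>z. g (fst z) (snd z))"
  shows "ptime (\<lambda>x. List.bind (l x) (g x))"
proof -
  have eq: "foldl (\<lambda>a y. a @ g x y) a ys = a @ List.bind ys (g x)" for x a ys
    by (induction ys arbitrary: a) (auto simp: bind_def)
  obtain q where q: "\<And>z. esize (g (fst z) (snd z)) \<le> poly q (esize z)"
    using ptime_poly_bounded[OF g] unfolding poly_bounded_def by blast
  \<comment> \<open>As \<open>b\<close> bounds the entries, one polynomial value bounds each piece
    \<open>g x y\<close>, and the total size is linear in the number of pieces.\<close>
  have size: "esize (List.bind ys (g x)) \<le> length ys * poly q (esize x + b + 1) + 1"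
    if "\<And>y. y \<in> set ys \<Longrightarrow> esize y \<le> b" for x ys b
    using that
  proof (induction ys)
    case (Cons y ys)
    have "esize (g x y) \<le> poly q (esize (x, y))" using q[of "(x, y)"] by simp
    also have "\<dots> \<le> poly q (esize x + b + 1)"
      by (rule poly_nat_mono) (use Cons.prems[of y] in simp)
    finally show ?case
      using Cons esize_append[of "g x y" "List.bind ys (g x)"] by (simp add: bind_def)
  qed (simp add: bind_def)
  have "ptime (\<lambda>x. foldl (\<lambda>a y. a @ g x y) [] (l x))"
  proof (rule ptime_foldl)
    show "ptime (\<lambda>z. fst (snd z) @ g (fst z) (snd (snd z)))"
      by (intro ptime_intros ptime_comp2[OF g])
    show "poly_bounded (\<lambda>x. esize (l x) * poly q (esize x + esize (l x) + 1) + 1)"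
      by (intro bound_intros l)
    fix x ys zs assume *: "l x = ys @ zs"
    have "esize (List.bind ys (g x)) \<le> length ys * poly q (esize x + esize (l x) + 1) + 1"
      by (rule size) (use * esize_mem_le[of _ "l x"] in simp)
    also have "\<dots> \<le> esize (l x) * poly q (esize x + esize (l x) + 1) + 1"
      using length_le_esize[of "l x"] * by (intro add_mono mult_mono) auto
    finally show "esize (foldl (\<lambda>a y. a @ g x y) [] ys) \<le> esize (l x) * poly q (esize x + esize (l x) + 1) + 1"
      by (simp add: eq)
  qed (intro ptime_intros l)+
  then show ?thesis by (simp add: eq)
qed

lemma ptime_map:
  assumes l: "ptime l" and g: "ptime (\<lambda>z. g (fst z) (snd z))"
  shows "ptime (\<lambda>x. map (g x) (l x))"
proof -
  have "List.bind ys (\<lambda>y. [f y]) = map f ys" for ys :: "'b list" and f :: "'b \<Rightarrow> 'c"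
    by (induction ys) (simp_all add: bind_def)
  then show ?thesis using ptime_bind[OF l, of "\<lambda>x y. [g x y]"] by (simp add: ptime_Cons ptime_const g)
qed

lemma ptime_list_all:
  assumes l: "ptime l" and g: "ptime (\<lambda>z. g (fst z) (snd z))"
  shows "ptime (\<lambda>x. list_all (g x) (l x))"
proof -
  have eq: "foldl (\<lambda>a y. a \<and> g x y) a ys \<longleftrightarrow> a \<and> list_all (g x) ys" for x a ys
    by (induction ys arbitrary: a) auto
  have "ptime (\<lambda>x. foldl (\<lambda>a y. a \<and> g x y) True (l x))"
  proof (rule ptime_foldl)
    show "ptime (\<lambda>z. fst (snd z) \<and> g (fst z) (snd (snd z)))"
      by (intro ptime_intros ptime_comp2[OF g])
  qed (rule l poly_bounded_const ptime_const esize_bool_le)+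
  then show ?thesis by (simp add: eq)
qed

section \<open>The algorithm\<close>

text \<open>To walk through two lists in one fold, the second list is carried in the accumulator and
  shortened along the way. Once it is exhausted nothing more is produced, in agreement with the
  truncation by \<open>map2\<close>.\<close>

lemma foldl_zip:
  "foldl (\<lambda>s x. case snd s of [] \<Rightarrow> (fst s, []) | y # ys \<Rightarrow> (f x y # fst s, ys)) (acc, ys) xs =
    (rev (map2 f xs ys) @ acc, drop (length xs) ys)"
proof (induction xs arbitrary: acc ys)
  case (Cons x xs)
  then show ?case by (cases ys) simp_all
qed simp

text \<open>With Boolean results the size of the accumulator is linear in its length, and this
  yields the bound that \<open>ptime_foldl\<close> asks for.\<close>

lemma ptime_map2:
  fixes f :: "bool \<Rightarrow> bool \<Rightarrow> bool"
  assumes f: "ptime (\<lambda>z. f (fst z) (snd z))" and a: "ptime a" and b: "ptime b"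
  shows "ptime (\<lambda>x. map2 f (a x) (b x))"
proof -
  let ?g = "\<lambda>s x. case snd s of [] \<Rightarrow> (fst s, []) | y # ys \<Rightarrow> (f x y # fst s, ys)"
  have "ptime (\<lambda>x. foldl ?g ([], b x) (a x))"
  proof (rule ptime_foldl)
    show "poly_bounded (\<lambda>x. 4 * esize (a x) + esize (b x) + 2)"
      by (intro bound_intros a b)
    fix x ys zs assume *: "a x = ys @ zs"
    have "esize (rev (map2 f ys (b x))) \<le> 4 * length (rev (map2 f ys (b x))) + 1"
      by (rule esize_bool_list_le)
    also have "\<dots> \<le> 4 * esize (a x) + 1"
      using length_le_esize[of "a x"] * by simp
    finally have 1: "esize (rev (map2 f ys (b x))) \<le> 4 * esize (a x) + 1" .
    have "esize (drop (length ys) (b x)) \<le> esize (b x)"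
      using esize_append[of "take (length ys) (b x)" "drop (length ys) (b x)"]
        tree_size_ge_1[of "encode (take (length ys) (b x))"] by simp
    with 1 show "esize (foldl ?g ([], b x) ys) \<le> 4 * esize (a x) + esize (b x) + 2"
      by (simp add: foldl_zip)
  qed (intro ptime_intros a b ptime_comp2[OF f])+
  from ptime_rev[OF ptime_fst[OF this]] show ?thesis
    by (simp add: foldl_zip)
qed

definition vunion :: "bool list \<Rightarrow> bool list \<Rightarrow> bool list" where
  "vunion u v = map2 (\<or>) u v"

definition vinter :: "bool list \<Rightarrow> bool list \<Rightarrow> bool list" where
  "vinter u v = map2 (\<and>) u v"

definition vsubset :: "bool list \<Rightarrow> bool list \<Rightarrow> bool" where
  "vsubset u v = list_all (\<lambda>b. b) (map2 (\<longrightarrow>) u v)"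

lemma ptime_vunion [ptime_intros]: "ptime a \<Longrightarrow> ptime b \<Longrightarrow> ptime (\<lambda>x. vunion (a x) (b x))"
  unfolding vunion_def by (rule ptime_map2; (intro ptime_intros)?)

lemma ptime_vinter [ptime_intros]: "ptime a \<Longrightarrow> ptime b \<Longrightarrow> ptime (\<lambda>x. vinter (a x) (b x))"
  unfolding vinter_def by (rule ptime_map2; (intro ptime_intros)?)

lemma ptime_vsubset [ptime_intros]: "ptime a \<Longrightarrow> ptime b \<Longrightarrow> ptime (\<lambda>x. vsubset (a x) (b x))"
  unfolding vsubset_def by (rule ptime_list_all, rule ptime_map2; (intro ptime_intros)?)

lemma length_foldl_le:
  assumes "\<And>a y. length (f a y) \<le> length a"
  shows "length (foldl f a ys) \<le> length a"
  using assms by (induction ys arbitrary: a) (auto intro: order_trans)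

text \<open>For a bit vector, length controls size. Steps that never lengthen the accumulator thus
  cannot cause compounded growth.\<close>

lemma ptime_foldl_shrink:
  fixes g :: "'a::encodable \<Rightarrow> bool list \<Rightarrow> 'b::encodable \<Rightarrow> bool list"
  assumes "ptime (\<lambda>z. g (fst z) (fst (snd z)) (snd (snd z)))" "ptime i" "ptime l"
    and le: "\<And>x a y. length (g x a y) \<le> length a"
  shows "ptime (\<lambda>x. foldl (g x) (i x) (l x))"
proof (rule ptime_foldl)
  show "poly_bounded (\<lambda>x. 4 * esize (i x) + 1)"
    by (intro bound_intros assms)
  fix x ys
  have "esize (foldl (g x) (i x) ys) \<le> 4 * length (foldl (g x) (i x) ys) + 1"
    by (rule esize_bool_list_le)
  also have "\<dots> \<le> 4 * esize (i x) + 1"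
    using length_foldl_le[of "g x" "i x" ys] le length_le_esize[of "i x"] by fastforce
  finally show "esize (foldl (g x) (i x) ys) \<le> 4 * esize (i x) + 1" .
qed (rule assms)+

section \<open>The search procedure\<close>

type_synonym input = "bool list \<times> (bool list \<times> bool list) list \<times> bool list list"

definition fire :: "bool list \<Rightarrow> bool list \<times> bool list \<Rightarrow> bool list" where
  "fire F i = (if vsubset (fst i) F then vunion F (snd i) else F)"

text \<open>Forward chaining. The list \<open>fst w\<close>, the vector of all of \<open>X\<close>,
  serves as a counter: as many rounds as \<open>X\<close> has elements reach the fixed
  point.\<close>

definition close :: "input \<Rightarrow> bool list \<Rightarrow> bool list" where
  "close w F = foldl (\<lambda>F _. foldl fire F (fst (snd w))) F (fst w)"

definition consistent :: "input \<Rightarrow> bool list \<Rightarrow> bool" where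
  "consistent w F = list_all (\<lambda>e. \<not> vsubset e (close w F)) (snd (snd w))"

text \<open>The first component lists the singletons, the second one is the empty set.\<close>

definition singletons :: "input \<Rightarrow> bool list list \<times> bool list" where
  "singletons w = foldl (\<lambda>a _. ((True # snd a) # map (\<lambda>u. False # u) (fst a), False # snd a)) ([], []) (fst w)"

definition try_add :: "input \<Rightarrow> bool list \<Rightarrow> bool list \<Rightarrow> bool list" where
  "try_add w F u = (if consistent w (vunion F u) then vunion F u else F)"

definition extend :: "input \<Rightarrow> bool list \<Rightarrow> bool list" where
  "extend w F = foldl (try_add w) F (fst (singletons w))"

definition combine :: "('a \<Rightarrow> 'b \<Rightarrow> 'c) \<Rightarrow> 'a list \<Rightarrow> 'b list \<Rightarrow> 'c list" where
  "combine f as bs = List.bind as (\<lambda>a. map (f a) bs)"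

text \<open>The inner iteration intersects \<open>X\<close> with \<open>m\<close> members of
  \<open>S\<close>, repetitions allowed. The outer one adjoins up to \<open>m\<close> elements,
  where the empty vector stands for adding nothing. Starting also from the empty set produces the
  plain sets \<open>W\<close>, even when \<open>S\<close> is empty.\<close>

definition candidates :: "nat \<Rightarrow> input \<Rightarrow> bool list list \<Rightarrow> bool list list" where
  "candidates m w S =
    ((\<lambda>L. combine vunion L (snd (singletons w) # fst (singletons w))) ^^ m)
      (snd (singletons w) # ((\<lambda>L. combine vinter L S) ^^ m) [fst w])"

text \<open>A solution may be listed several times; the enumeration loop takes only the head of the
  list and tests for emptiness.\<close>

definition search :: "nat \<Rightarrow> input \<Rightarrow> bool list list \<Rightarrow> bool list list" where
  "search m w S = List.bind (candidates m w S)
    (\<lambda>Y. if consistent w Y \<and> list_all (\<lambda>F. \<not> vsubset Y F) S then [extend w Y] else [])"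

section \<open>Polynomial running time of the search\<close>

lemma length_vunion_le: "length (vunion u v) \<le> length u"
  by (simp add: vunion_def)

lemma ptime_close [ptime_intros]:
  assumes "ptime w" "ptime F"
  shows "ptime (\<lambda>x. close (w x) (F x))"
  unfolding close_def fire_def
  by (intro ptime_intros ptime_foldl_shrink length_foldl_le assms ptime_comp[OF _ assms(1)])
    (simp_all add: length_vunion_le)

lemma ptime_consistent [ptime_intros]:
  assumes "ptime w" "ptime F"
  shows "ptime (\<lambda>x. consistent (w x) (F x))"
  unfolding consistent_def 
  by (rule ptime_list_all; intro ptime_intros assms ptime_comp[OF _ assms(1)] ptime_comp[OF _ assms(2)])

lemma singletons_size:
  assumes "foldl (\<lambda>a _. ((True # snd a) # map (\<lambda>u. False # u) (fst a), False # snd a)) ([], []) ys = a"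
  shows "length (fst a) = length ys \<and> (\<forall>u \<in> set (fst a). length u = length ys) \<and> length (snd a) = length ys"
  using assms by (induction ys arbitrary: a rule: rev_induct) auto

lemma ptime_singletons [ptime_intros]:
  assumes "ptime w"
  shows "ptime (\<lambda>x. singletons (w x))"
proof -
  let ?f = "\<lambda>a _. ((True # snd a) # map (\<lambda>u. False # u) (fst a), False # snd a)"
  have "ptime (\<lambda>x. foldl ?f ([], []) (fst (w x)))"
  proof (rule ptime_foldl)
    let ?n = "\<lambda>x. esize (fst (w x))"
    show "poly_bounded (\<lambda>x. (?n x * Suc (4 * ?n x + 1) + 1) + (4 * ?n x + 1) + 1)"
      by (intro bound_intros ptime_intros assms)
    fix x ys zs assume *: "fst (w x) = ys @ zs"
    obtain us z where a: "foldl ?f ([], []) ys = (us, z)" by fastforce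
    have l: "length us = length ys" "\<And>u. u \<in> set us \<Longrightarrow> length u = length ys" "length z = length ys"
      using singletons_size[OF a] by auto
    have n: "length ys \<le> ?n x"
      using * length_le_esize[of "fst (w x)"] by simp
    have "esize us \<le> length us * Suc (4 * length ys + 1) + 1"
      by (rule esize_list_le) (metis esize_bool_list_le l(2))
    also have "\<dots> \<le> ?n x * Suc (4 * ?n x + 1) + 1"
      using n l(1) by (intro add_mono mult_mono) auto
    finally show "esize (foldl ?f ([], []) ys) \<le> (?n x * Suc (4 * ?n x + 1) + 1) + (4 * ?n x + 1) + 1"
      using esize_bool_list_le[of z] n l(3) by (simp add: a)
  qed (intro ptime_intros ptime_map assms)+
  then show ?thesis unfolding singletons_def .
qed

lemma ptime_extend [ptime_intros]:
  assumes "ptime w" "ptime F"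
  shows "ptime (\<lambda>x. extend (w x) (F x))"
  unfolding extend_def
proof (rule ptime_foldl_shrink)
  show "ptime (\<lambda>z. try_add (w (fst z)) (fst (snd z)) (snd (snd z)))"
    unfolding try_add_def by (intro ptime_intros ptime_comp[OF _ assms(1)])
  show "length (try_add (w x) a y) \<le> length a" for x a y
    by (simp add: try_add_def length_vunion_le)
qed (intro ptime_intros assms)+

lemma ptime_combine [ptime_intros]:
  assumes f: "ptime (\<lambda>z. f (fst z) (snd z))" and a: "ptime a" and b: "ptime b"
  shows "ptime (\<lambda>x. combine f (a x) (b x))"
  unfolding combine_def
  by (rule ptime_bind[OF a]; rule ptime_map; intro ptime_intros ptime_comp[OF _ b] ptime_comp2[OF f])

text \<open>Induction on \<open>m\<close> builds a separate program and polynomial for each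
  \<open>m\<close>. The list may grow by a factor \<open>length (b x)\<close> in each round, so it
  is essential that \<open>m\<close> is a constant.\<close>

lemma ptime_funpow_combine:
  fixes f :: "'a::encodable \<Rightarrow> 'b::encodable \<Rightarrow> 'a"
  assumes "ptime (\<lambda>z. f (fst z) (snd z))" "ptime a" "ptime b"
  shows "ptime (\<lambda>x. ((\<lambda>L. combine f L (b x)) ^^ m) (a x))"
proof (induction m)
  case 0
  show ?case using assms(2) by simp
next
  case (Suc m)
  show ?case using ptime_combine[OF assms(1) Suc assms(3)] by simp
qed

lemma ptime_candidates [ptime_intros]:
  assumes "ptime w" "ptime S"
  shows "ptime (\<lambda>x. candidates m (w x) (S x))"
  unfolding candidates_def
  by (intro ptime_funpow_combine ptime_intros assms)

lemma ptime_search [ptime_intros]: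
  assumes "ptime w" "ptime S"
  shows "ptime (\<lambda>x. search m (w x) (S x))"
  unfolding search_def
  by (intro ptime_bind ptime_list_all ptime_intros assms ptime_comp[OF _ assms(1)] ptime_comp[OF _ assms(2)])

section \<open>Small witnesses for missing solutions\<close>

locale bounded_instance =
  fixes X :: "'a set" and \<Sigma> :: "'a implication set" and E :: "'a set set" and k :: nat
  assumes finite_X: "finite X"
    and base: "implicational_base X \<Sigma>"
    and graph: "simple_graph X E"
    and caratheodory: "caratheodory_number X (closed_sets X \<Sigma>) \<le> k"
begin

section \<open>Closure and consistency\<close>

abbreviation cl :: "'a set \<Rightarrow> 'a set" where
  "cl Y \<equiv> closure_operator (closed_sets X \<Sigma>) Y"

abbreviation consist :: "'a set \<Rightarrow> bool" where
  "consist Y \<equiv> independent_set E (cl Y)"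

lemma X_closed: "X \<in> closed_sets X \<Sigma>"
  using base unfolding closed_sets_def satisfies_def implicational_base_def by auto

lemma cl_extensive: "Y \<subseteq> cl Y"
  unfolding closure_operator_def by blast

lemma cl_least: "F \<in> closed_sets X \<Sigma> \<Longrightarrow> Y \<subseteq> F \<Longrightarrow> cl Y \<subseteq> F"
  unfolding closure_operator_def by blast

lemma cl_subset: "Y \<subseteq> X \<Longrightarrow> cl Y \<subseteq> X"
  by (rule cl_least[OF X_closed])

lemma cl_closed: "Y \<subseteq> X \<Longrightarrow> cl Y \<in> closed_sets X \<Sigma>"
proof -
  assume "Y \<subseteq> X"
  have "B \<subseteq> cl Y" if "(A, B) \<in> \<Sigma>" "A \<subseteq> cl Y" for A B
    unfolding closure_operator_def
  proof (rule Inter_greatest)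
    fix F assume "F \<in> {F \<in> closed_sets X \<Sigma>. Y \<subseteq> F}"
    then have F: "F \<in> closed_sets X \<Sigma>" "Y \<subseteq> F" by simp_all
    have "A \<subseteq> F" using that(2) cl_least[OF F] by (rule subset_trans)
    then show "B \<subseteq> F" using F(1) that(1) unfolding closed_sets_def satisfies_def by blast
  qed
  then show ?thesis
    using cl_subset[OF \<open>Y \<subseteq> X\<close>] unfolding closed_sets_def satisfies_def by blast
qed

lemma cl_mono: "Y \<subseteq> Z \<Longrightarrow> cl Y \<subseteq> cl Z"
  unfolding closure_operator_def by blast

lemma cl_eq_of_closed: "F \<in> closed_sets X \<Sigma> \<Longrightarrow> cl F = F"
  using cl_least[of F F] cl_extensive by blast

lemma consist_antimono: "consist Z \<Longrightarrow> Y \<subseteq> Z \<Longrightarrow> consist Y"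
  using cl_mono[of Y Z] unfolding independent_set_def by blast

lemma caratheodory_witness:
  assumes "A \<subseteq> X" "x \<in> cl A"
  obtains A' where "A' \<subseteq> A" "card A' \<le> k" "x \<in> cl A'"
proof -
  let ?P = "\<lambda>k. \<forall>A x. A \<subseteq> X \<longrightarrow> x \<in> X \<longrightarrow> x \<in> cl A \<longrightarrow> (\<exists>A'. A' \<subseteq> A \<and> card A' \<le> k \<and> x \<in> cl A')"
  \<comment> \<open>\<open>LeastI\<close> needs one admissible bound; for \<open>card X\<close>
    every \<open>A\<close> is its own witness.\<close>
  have "?P (card X)"
  proof (intro allI impI)
    fix A x assume "A \<subseteq> X" "x \<in> cl A"
    then show "\<exists>A'. A' \<subseteq> A \<and> card A' \<le> card X \<and> x \<in> cl A'"
      by (intro exI[of _ A]) (simp add: card_mono[OF finite_X])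
  qed
  then have *: "?P (caratheodory_number X (closed_sets X \<Sigma>))"
    unfolding caratheodory_number_def by (rule LeastI)
  have "x \<in> X" using cl_subset[OF assms(1)] assms(2) by (rule subsetD)
  with * assms obtain A' where
    A': "A' \<subseteq> A \<and> card A' \<le> caratheodory_number X (closed_sets X \<Sigma>) \<and> x \<in> cl A'"
    by presburger
  show thesis
  proof (rule that)
    show "A' \<subseteq> A" "x \<in> cl A'" using A' by simp_all
    show "card A' \<le> k" using conjunct1[OF conjunct2[OF A']] caratheodory by (rule le_trans)
  qed
qed

lemma inconsistent_witness:
  assumes "Y \<subseteq> X" "\<not> consist Y"
  obtains Z where "Z \<subseteq> Y" "card Z \<le> 2 * k" "\<not> consist Z"
proof -
  obtain u v where uv: "u \<in> cl Y" "v \<in> cl Y" "{u, v} \<in> E"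
    using assms(2) unfolding independent_set_def by blast
  obtain A where A: "A \<subseteq> Y" "card A \<le> k" "u \<in> cl A"
    by (rule caratheodory_witness[OF assms(1) uv(1)])
  obtain B where B: "B \<subseteq> Y" "card B \<le> k" "v \<in> cl B"
    by (rule caratheodory_witness[OF assms(1) uv(2)])
  show thesis
  proof (rule that)
    show "card (A \<union> B) \<le> 2 * k" using card_Un_le[of A B] A(2) B(2) by linarith
    show "\<not> consist (A \<union> B)"
      using A(3) B(3) cl_mono[of A "A \<union> B"] cl_mono[of B "A \<union> B"] uv(3)
      unfolding independent_set_def by blast
  qed (use A B in blast)
qed

lemma maxCC_D:
  assumes "F \<in> maxCC X \<Sigma> E"
  shows "F \<subseteq> X" "consist F"
  using assms cl_eq_of_closed unfolding maxCC_def consistent_closed_sets_def closed_sets_def by auto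

lemma maxCC_subset_eq:
  assumes "F \<in> maxCC X \<Sigma> E" "G \<in> maxCC X \<Sigma> E" "F \<subseteq> G"
  shows "F = G"
  using assms unfolding maxCC_def by blast

text \<open>Since consistency passes to subsets, maximality need only be tested by adding single
  elements. This is the form in which a greedy procedure establishes it.\<close>

lemma maxCC_I:
  assumes F: "F \<subseteq> X" "consist F" and add: "\<And>x. x \<in> X \<Longrightarrow> consist (insert x F) \<Longrightarrow> x \<in> F"
  shows "F \<in> maxCC X \<Sigma> E"
proof -
  \<comment> \<open>Adding an element of the closure keeps the set inside a consistent one, so
    \<open>add\<close> already forces \<open>F\<close> to be closed.\<close>
  have "cl F \<subseteq> F"
  proof
    fix x assume x: "x \<in> cl F"
    have "cl (cl F) = cl F" by (rule cl_eq_of_closed[OF cl_closed[OF F(1)]])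
    then have "consist (cl F)" using F(2) by simp
    then have "consist (insert x F)"
      by (rule consist_antimono) (use x cl_extensive in blast)
    then show "x \<in> F" using add[of x] x cl_subset[OF F(1)] by blast
  qed
  then have cl: "cl F = F" using cl_extensive by blast
  then have "F \<in> closed_sets X \<Sigma>" using cl_closed[OF F(1)] by simp
  moreover have max: "G = F" if G: "G \<in> closed_sets X \<Sigma>" "independent_set E G" "F \<subseteq> G" for G
  proof -
    have "consist G" using cl_eq_of_closed[OF G(1)] G(2) by simp
    have "G \<subseteq> F"
    proof
      fix x assume x: "x \<in> G"
      have "x \<in> X" using x G(1) unfolding closed_sets_def by blast
      moreover have "consist (insert x F)"
        using \<open>consist G\<close> by (rule consist_antimono) (use x G(3) in simp)
      ultimately show "x \<in> F" by (rule add)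
    qed
    then show ?thesis using G(3) by simp
  qed
  moreover have "independent_set E F" using F(2) cl by simp
  ultimately have "F \<in> consistent_closed_sets X \<Sigma> E"
    unfolding consistent_closed_sets_def by simp
  moreover have "\<forall>G \<in> consistent_closed_sets X \<Sigma> E. F \<subseteq> G \<longrightarrow> G = F"
    unfolding consistent_closed_sets_def by (intro ballI impI max) auto
  ultimately show ?thesis
    unfolding maxCC_def by (intro CollectI conjI)
qed

section \<open>Consistent sets contained in no known solution\<close>

definition uncovered :: "'a set set \<Rightarrow> 'a set \<Rightarrow> bool" where
  "uncovered S Y \<longleftrightarrow> (\<forall>G \<in> S. \<not> Y \<subseteq> G)"

lemma uncovered_witness:
  assumes S: "\<And>G. G \<in> S \<Longrightarrow> consist G"
    and F: "F \<subseteq> X" "consist F" "uncovered S F"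
  obtains W where "W \<subseteq> X" "card W \<le> 2 * k + 1" "consist W" "uncovered S W"
  | W G where "W \<subseteq> X" "card W = 2 * k + 1" "G ` W \<subseteq> S"
      "consist (X \<inter> (\<Inter>w \<in> W. G w) \<union> W)" "uncovered S (X \<inter> (\<Inter>w \<in> W. G w) \<union> W)"
proof -
  \<comment> \<open>Minimality is by cardinality, so deleting any one element from \<open>Y\<close>
    yields a set that some member of \<open>S\<close> contains.\<close>
  have "\<exists>Y. (Y \<subseteq> F \<and> uncovered S Y) \<and> (\<forall>Z. Z \<subseteq> F \<and> uncovered S Z \<longrightarrow> card Y \<le> card Z)"
    by (rule ex_has_least_nat[of _ F]) (simp add: F(3))
  then obtain Y where Y: "Y \<subseteq> F" "uncovered S Y"
    and min: "\<And>Z. Z \<subseteq> F \<Longrightarrow> uncovered S Z \<Longrightarrow> card Y \<le> card Z"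
    by auto
  have fin: "finite Y" using Y(1) F(1) finite_X by (meson finite_subset)
  show thesis
  proof (cases "card Y \<le> 2 * k + 1")
    case True
    show thesis
      by (rule that(1)[OF _ True consist_antimono[OF F(2) Y(1)] Y(2)]) (use Y F in blast)
  next
    case False
    then obtain W where W: "W \<subseteq> Y" "card W = 2 * k + 1"
      using obtain_subset_with_card_n[of "2 * k + 1" Y] by auto
    have "\<exists>G. G \<in> S \<and> Y - {w} \<subseteq> G" if w: "w \<in> W" for w
    proof (rule ccontr)
      assume "\<nexists>G. G \<in> S \<and> Y - {w} \<subseteq> G"
      then have "card Y \<le> card (Y - {w})"
        by (intro min) (use Y in \<open>auto simp: uncovered_def\<close>)
      then show False using card_Diff1_less[OF fin, of w] w W by auto
    qed
    then obtain G where G: "\<And>w. w \<in> W \<Longrightarrow> G w \<in> S" "\<And>w. w \<in> W \<Longrightarrow> Y - {w} \<subseteq> G w"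
      by metis
    let ?I = "X \<inter> (\<Inter>w \<in> W. G w)"
    have "Y \<subseteq> ?I \<union> W" using G(2) Y(1) F(1) by blast
    then have unc: "uncovered S (?I \<union> W)" using Y(2) unfolding uncovered_def by blast
    have WX: "W \<subseteq> X" using W Y F by blast
    have con: "consist (?I \<union> W)"
    proof (rule ccontr)
      assume inc: "\<not> consist (?I \<union> W)"
      have "?I \<union> W \<subseteq> X" using WX by blast
      then obtain Z where Z: "Z \<subseteq> ?I \<union> W" "card Z \<le> 2 * k" "\<not> consist Z"
        using inc by (rule inconsistent_witness)
      have "Z \<subseteq> X" using Z(1) WX by blast
      then have "finite Z" using finite_X by (rule finite_subset)
      \<comment> \<open>Here the size \<open>2 * k + 1\<close> matters: it exceeds the size of
        \<open>Z\<close> by at least one, so \<open>Z\<close> misses some \<open>w\<close>.\<close>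
      then have "\<not> W \<subseteq> Z" using card_mono[of Z W] Z(2) W(2) by linarith
      then obtain w where w: "w \<in> W" "w \<notin> Z" by blast
      \<comment> \<open>The elements of \<open>Z\<close> in \<open>?I\<close> lie in every
        \<open>G w\<close>. Those in \<open>W\<close> differ from \<open>w\<close>, hence lie in
        \<open>Y - {w}\<close>.\<close>
      have "Z \<subseteq> G w" using Z(1) G(2)[OF w(1)] w W(1) by blast
      then show False using consist_antimono[OF S[OF G(1)[OF w(1)]]] Z(3) by blast
    qed
    show thesis
      by (rule that(2)[OF WX W(2) _ con unc]) (use G(1) in blast)
  qed
qed

section \<open>Greedy extension to a solution\<close>

definition grow :: "'a set \<Rightarrow> 'a \<Rightarrow> 'a set" where
  "grow F x = (if consist (insert x F) then insert x F else F)"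

text \<open>An element rejected once stays rejected, because the set only grows and consistency
  passes to subsets. A single pass is therefore enough.\<close>

lemma foldl_grow:
  assumes "F \<subseteq> X" "consist F" "set ys \<subseteq> X"
  shows "F \<subseteq> foldl grow F ys \<and> foldl grow F ys \<subseteq> X \<and> consist (foldl grow F ys) \<and>
    (\<forall>x \<in> set ys. consist (insert x (foldl grow F ys)) \<longrightarrow> x \<in> foldl grow F ys)"
  using assms
proof (induction ys arbitrary: F)
  case (Cons y ys)
  have "grow F y \<subseteq> X" "consist (grow F y)" "F \<subseteq> grow F y"
    using Cons.prems unfolding grow_def by simp_all blast
  define Z where "Z = foldl grow (grow F y) ys"
  have Z: "foldl grow F (y # ys) = Z" by (simp add: Z_def)
  have IH: "grow F y \<subseteq> Z" "Z \<subseteq> X" "consist Z" "\<forall>x \<in> set ys. consist (insert x Z) \<longrightarrow> x \<in> Z"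
    using Cons.IH[of "grow F y"] \<open>grow F y \<subseteq> X\<close> \<open>consist (grow F y)\<close> Cons.prems(3)
    unfolding Z_def by auto
  have "y \<in> Z" if "consist (insert y Z)"
  proof -
    have "consist (insert y F)"
      using that by (rule consist_antimono) (use IH(1) \<open>F \<subseteq> grow F y\<close> in blast)
    then have "grow F y = insert y F" unfolding grow_def by simp
    then show ?thesis using IH(1) by simp
  qed
  moreover have "F \<subseteq> Z" using IH(1) \<open>F \<subseteq> grow F y\<close> by (rule subset_trans[rotated])
  ultimately show ?case unfolding Z using IH(2-4) by simp
qed simp

lemma foldl_grow_maxCC:
  assumes "F \<subseteq> X" "consist F" "set ys = X"
  shows "foldl grow F ys \<in> maxCC X \<Sigma> E" "F \<subseteq> foldl grow F ys"
proof -
  have ys: "set ys \<subseteq> X" using assms(3) by simp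
  note * = foldl_grow[OF assms(1,2) ys]
  show "F \<subseteq> foldl grow F ys" by (rule conjunct1[OF *])
  show "foldl grow F ys \<in> maxCC X \<Sigma> E"
  proof (rule maxCC_I)
    show "foldl grow F ys \<subseteq> X" "consist (foldl grow F ys)" using * by simp_all
    fix x assume x: "x \<in> X" "consist (insert x (foldl grow F ys))"
    have "x \<in> set ys" using x(1) assms(3) by simp
    then show "x \<in> foldl grow F ys" using * x(2) by simp
  qed
qed

end

section \<open>Correctness of the search\<close>

definition vec :: "'a list \<Rightarrow> 'a set \<Rightarrow> bool list" where
  "vec xs A = map (\<lambda>x. x \<in> A) xs"

lemma length_vec [simp]: "length (vec xs A) = length xs"
  by (simp add: vec_def)

lemma encode_vec: "encode (vec xs A) = code_set xs A"
  by (simp add: vec_def code_set_def encode_list_def encode_bool_def comp_def)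

lemma vunion_vec: "vunion (vec xs A) (vec xs B) = vec xs (A \<union> B)"
  unfolding vunion_def vec_def by (induction xs) auto

lemma vinter_vec: "vinter (vec xs A) (vec xs B) = vec xs (A \<inter> B)"
  unfolding vinter_def vec_def by (induction xs) auto

lemma vsubset_vec: "A \<subseteq> set xs \<Longrightarrow> vsubset (vec xs A) (vec xs B) \<longleftrightarrow> A \<subseteq> B"
proof -
  assume "A \<subseteq> set xs"
  moreover have "vsubset (vec xs A) (vec xs B) \<longleftrightarrow> (\<forall>x \<in> set xs. x \<in> A \<longrightarrow> x \<in> B)"
    unfolding vsubset_def vec_def by (induction xs) auto
  ultimately show ?thesis by blast
qed

lemma inj_on_vec: "inj_on (vec xs) (Pow (set xs))"
  by (rule inj_onI) (auto simp: vec_def)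

lemma foldl_const: "foldl (\<lambda>a _. f a) a xs = (f ^^ length xs) a"
  by (induction xs arbitrary: a) (simp_all add: funpow_swap1)

section \<open>Forward chaining as a fixed-point iteration\<close>

lemma inflationary_funpow:
  assumes X: "finite X" "Y \<subseteq> X" and f: "\<And>F. F \<subseteq> X \<Longrightarrow> F \<subseteq> f F \<and> f F \<subseteq> X"
  shows "Y \<subseteq> (f ^^ n) Y \<and> (f ^^ n) Y \<subseteq> X"
proof (induction n)
  case (Suc n)
  then show ?case using f[of "(f ^^ n) Y"] by auto
qed (simp add: X)

text \<open>Every round before the fixed point is reached adds an element.\<close>

lemma inflationary_funpow_fixpoint:
  assumes X: "finite X" "Y \<subseteq> X" and f: "\<And>F. F \<subseteq> X \<Longrightarrow> F \<subseteq> f F \<and> f F \<subseteq> X"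
  shows "f ((f ^^ card X) Y) = (f ^^ card X) Y"
proof -
  note sub = inflationary_funpow[OF assms]
  have step: "f ((f ^^ n) Y) = (f ^^ n) Y \<or> n \<le> card ((f ^^ n) Y)" for n
  proof (induction n)
    case (Suc n)
    let ?Z = "(f ^^ n) Y"
    show ?case
    proof (cases "f ?Z = ?Z")
      case False
      then have "?Z \<subset> f ?Z" using f[of ?Z] sub[of n] by blast
      moreover have "finite (f ?Z)" using f[of ?Z] sub[of n] X(1) finite_subset by blast
      ultimately have "card ?Z < card (f ?Z)" by (rule psubset_card_mono[rotated])
      then show ?thesis using Suc False by simp
    qed simp
  qed simp
  show ?thesis
  proof (cases "f ((f ^^ card X) Y) = (f ^^ card X) Y")
    case False
    \<comment> \<open>Without a fixed point the iterate has at least \<open>card X\<close> elements,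
      so it is \<open>X\<close>, which \<open>f\<close> cannot enlarge.\<close>
    then have "(f ^^ card X) Y = X"
      using step[of "card X"] sub[of "card X"] X(1) by (simp add: card_seteq)
    then show ?thesis using f[of X] by auto
  qed
qed

definition fire_set :: "'a set \<Rightarrow> 'a implication \<Rightarrow> 'a set" where
  "fire_set F i = (if fst i \<subseteq> F then F \<union> snd i else F)"

lemma fire_set_increasing: "F \<subseteq> fire_set F i"
  by (auto simp: fire_set_def)

lemma foldl_fire_set_increasing: "F \<subseteq> foldl fire_set F is"
proof (induction "is" arbitrary: F)
  case (Cons i "is")
  show ?case using fire_set_increasing[of F i] Cons[of "fire_set F i"] by auto
qed simp

lemma foldl_fire_set_le:
  assumes "satisfies G (set is)" "F \<subseteq> G"
  shows "foldl fire_set F is \<subseteq> G"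
  using assms
proof (induction "is" arbitrary: F)
  case (Cons i "is")
  have "fire_set F i \<subseteq> G" using Cons.prems by (cases i) (auto simp: fire_set_def satisfies_def)
  moreover have "satisfies G (set is)" using Cons.prems(1) by (simp add: satisfies_def)
  ultimately show ?case using Cons.IH by simp
qed simp

text \<open>Single steps only add elements, so a pass that ends where it began has changed nothing
  at any step.\<close>

lemma foldl_fire_set_fixpoint:
  assumes "foldl fire_set F is = F"
  shows "satisfies F (set is)"
  using assms
proof (induction "is")
  case (Cons i "is")
  have "fire_set F i \<subseteq> F" using foldl_fire_set_increasing[of "fire_set F i" "is"] Cons.prems by simp
  then have F: "fire_set F i = F" using fire_set_increasing[of F i] by simp
  then have "satisfies F (set is)" using Cons by simp
  moreover have "fst i \<subseteq> F \<longrightarrow> snd i \<subseteq> F" using F by (auto simp: fire_set_def split: if_splits)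
  ultimately show ?case by (cases i) (simp add: satisfies_def)
qed (simp add: satisfies_def)

text \<open>Each further entry creates a position in front: the new unit vector gets index 0 and all
  earlier ones move up by one.\<close>

lemma singletons_unit_vectors:
  assumes "foldl (\<lambda>a _. ((True # snd a) # map (\<lambda>u. False # u) (fst a), False # snd a)) ([], []) ys = a"
  shows "snd a = replicate (length ys) False \<and>
    set (fst a) = (\<lambda>i. (replicate (length ys) False)[i := True]) ` {..<length ys}"
  using assms
proof (induction ys arbitrary: a rule: rev_induct)
  case (snoc y ys)
  then show ?case
    by (auto simp: lessThan_Suc_eq_insert_0 image_image)
qed simp

section \<open>The algorithm run on a coded instance\<close>

locale coded_instance = bounded_instance +
  fixes xs :: "'a list" and ims :: "'a implication list" and es :: "'a set list"
  assumes xs: "distinct xs" "set xs = X" and ims: "set ims = \<Sigma>" and es: "set es = E"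
begin

definition w :: input where
  "w = (vec xs X, map (\<lambda>i. (vec xs (fst i), vec xs (snd i))) ims, map (vec xs) es)"

lemma encode_w: "encode w = code_input xs ims es"
proof -
  have "code_list (map (code_set xs) es) = encode (map (vec xs) es)"
    by (induction es) (simp_all add: encode_vec)
  moreover have "code_list (map (code_implication xs) ims) =
      encode (map (\<lambda>i. (vec xs (fst i), vec xs (snd i))) ims)"
    by (induction ims) (simp_all add: encode_vec code_implication_def)
  ultimately show ?thesis
    by (simp add: w_def code_input_def encode_vec xs(2))
qed

lemma foldl_fire_vec:
  assumes "set is \<subseteq> \<Sigma>"
  shows "foldl fire (vec xs F) (map (\<lambda>i. (vec xs (fst i), vec xs (snd i))) is) =
    vec xs (foldl fire_set F is)"
  using assms
proof (induction "is" arbitrary: F)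
  case (Cons i "is")
  have "i \<in> \<Sigma>" using Cons.prems by simp
  with base have "case i of (A, B) \<Rightarrow> A \<subseteq> X \<and> B \<subseteq> X"
    unfolding implicational_base_def by (rule bspec)
  then have "fst i \<subseteq> set xs" by (cases i) (simp add: xs(2))
  then have "fire (vec xs F) (vec xs (fst i), vec xs (snd i)) = vec xs (fire_set F i)"
    by (simp add: fire_def fire_set_def vsubset_vec vunion_vec)
  moreover have "set is \<subseteq> \<Sigma>" using Cons.prems by simp
  ultimately show ?case using Cons.IH[of "fire_set F i"] by simp
qed simp

lemma foldl_fire_set_subset: "G \<subseteq> X \<Longrightarrow> foldl fire_set G ims \<subseteq> X"
  using X_closed by (intro foldl_fire_set_le) (simp_all add: closed_sets_def ims)

text \<open>The fixed point satisfies all implications and contains \<open>F\<close>, so it contains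
  the closure; conversely no firing leads out of the closed set \<open>cl F\<close>.\<close>

lemma cl_eq_funpow:
  assumes "F \<subseteq> X"
  shows "cl F = ((\<lambda>F. foldl fire_set F ims) ^^ card X) F"
proof -
  define f where "f F = foldl fire_set F ims" for F
  have inc: "G \<subseteq> f G \<and> f G \<subseteq> X" if "G \<subseteq> X" for G
    unfolding f_def using foldl_fire_set_increasing foldl_fire_set_subset[OF that] by (rule conjI)
  have C: "F \<subseteq> (f ^^ card X) F \<and> (f ^^ card X) F \<subseteq> X"
    by (rule inflationary_funpow[OF finite_X assms inc])
  have "f ((f ^^ card X) F) = (f ^^ card X) F"
    by (rule inflationary_funpow_fixpoint[OF finite_X assms inc])
  then have "satisfies ((f ^^ card X) F) \<Sigma>"
    unfolding f_def ims[symmetric] by (rule foldl_fire_set_fixpoint)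
  then have "(f ^^ card X) F \<in> closed_sets X \<Sigma>" using C by (simp add: closed_sets_def)
  then have "cl F \<subseteq> (f ^^ card X) F" by (rule cl_least) (rule conjunct1[OF C])
  moreover have "(f ^^ n) F \<subseteq> cl F" for n
  proof (induction n)
    case 0
    show ?case using cl_extensive by simp
  next
    case (Suc n)
    have "cl F \<in> closed_sets X \<Sigma>" by (rule cl_closed[OF assms])
    then have "satisfies (cl F) (set ims)" using ims unfolding closed_sets_def by simp
    then have "f ((f ^^ n) F) \<subseteq> cl F" unfolding f_def[of "(f ^^ n) F"] using Suc by (rule foldl_fire_set_le)
    then show ?case by simp
  qed
  ultimately have "cl F = (f ^^ card X) F" by (intro subset_antisym)
  moreover have "f = (\<lambda>F. foldl fire_set F ims)" by (rule ext) (rule f_def)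
  ultimately show ?thesis by simp
qed

lemma close_vec:
  assumes "F \<subseteq> X"
  shows "close w (vec xs F) = vec xs (cl F)"
proof -
  have "close w (vec xs F) = ((\<lambda>F. foldl fire F (fst (snd w))) ^^ length (fst w)) (vec xs F)"
    unfolding close_def by (rule foldl_const)
  also have "length (fst w) = card X"
    using distinct_card[OF xs(1)] by (simp add: w_def xs(2))
  also have "((\<lambda>F. foldl fire F (fst (snd w))) ^^ n) (vec xs F) =
      vec xs (((\<lambda>F. foldl fire_set F ims) ^^ n) F)" for n
    by (induction n) (simp_all add: w_def foldl_fire_vec ims)
  also have "((\<lambda>F. foldl fire_set F ims) ^^ card X) F = cl F"
    by (rule cl_eq_funpow[OF assms, symmetric])
  finally show ?thesis .
qed

text \<open>The program tests whether an edge is a subset, whereas independence speaks of two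
  endpoints. The tests agree because every edge has exactly two elements.\<close>

lemma consistent_vec:
  assumes "F \<subseteq> X"
  shows "consistent w (vec xs F) \<longleftrightarrow> consist F"
proof -
  have e: "e \<subseteq> set xs" "card e = 2" if "e \<in> E" for e
    using bspec[OF graph[unfolded simple_graph_def] that] by (simp_all add: xs(2))
  have "consistent w (vec xs F) \<longleftrightarrow> (\<forall>e \<in> E. \<not> vsubset (vec xs e) (vec xs (cl F)))"
    unfolding consistent_def close_vec[OF assms] by (simp add: w_def list_all_iff es)
  also have "\<dots> \<longleftrightarrow> (\<forall>e \<in> E. \<not> e \<subseteq> cl F)"
    using e(1) by (intro ball_cong refl arg_cong[of _ _ Not] vsubset_vec)
  also have "\<dots> \<longleftrightarrow> consist F"
  proof
    assume *: "\<forall>e \<in> E. \<not> e \<subseteq> cl F"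
    show "consist F"
      unfolding independent_set_def
    proof (intro ballI notI)
      fix u v assume "u \<in> cl F" "v \<in> cl F" "{u, v} \<in> E"
      then show False using bspec[OF *, of "{u, v}"] by simp
    qed
  next
    assume *: "consist F"
    show "\<forall>e \<in> E. \<not> e \<subseteq> cl F"
    proof
      fix e assume "e \<in> E"
      moreover from e(2)[OF this] obtain u v where "e = {u, v}" by (auto simp: card_2_iff)
      ultimately show "\<not> e \<subseteq> cl F" using * unfolding independent_set_def by auto
    qed
  qed
  finally show ?thesis .
qed

lemma singletons_vec:
  "snd (singletons w) = vec xs {}" "set (fst (singletons w)) = (\<lambda>x. vec xs {x}) ` X"
proof -
  have *: "snd (singletons w) = replicate (length xs) False \<and>
      set (fst (singletons w)) = (\<lambda>i. (replicate (length xs) False)[i := True]) ` {..<length xs}"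
    using singletons_unit_vectors[OF refl, of "fst w"] unfolding singletons_def by (simp add: w_def)
  then show "snd (singletons w) = vec xs {}"
    by (simp add: vec_def map_replicate_const)
  have "(replicate (length xs) False)[i := True] = vec xs {xs ! i}" if "i < length xs" for i
    using that xs(1) by (intro nth_equalityI) (auto simp: vec_def nth_list_update nth_eq_iff_index_eq)
  then have "set (fst (singletons w)) = (\<lambda>i. vec xs {xs ! i}) ` {..<length xs}"
    unfolding conjunct2[OF *] by (intro image_cong) simp_all
  also have "\<dots> = (\<lambda>x. vec xs {x}) ` X"
    unfolding xs(2)[symmetric] set_conv_nth by auto
  finally show "set (fst (singletons w)) = (\<lambda>x. vec xs {x}) ` X" .
qed

lemma foldl_try_add_vec:
  assumes "F \<subseteq> X" "set ys \<subseteq> X"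
  shows "foldl (try_add w) (vec xs F) (map (\<lambda>x. vec xs {x}) ys) = vec xs (foldl grow F ys)"
  using assms
proof (induction ys arbitrary: F)
  case (Cons y ys)
  have "insert y F \<subseteq> X" using Cons.prems by simp
  then have "try_add w (vec xs F) (vec xs {y}) = vec xs (grow F y)" "grow F y \<subseteq> X"
    using Cons.prems(1) by (simp_all add: try_add_def grow_def vunion_vec consistent_vec)
  then show ?case using Cons.IH[of "grow F y"] Cons.prems(2) by simp
qed simp

lemma extend_vec:
  assumes "F \<subseteq> X" "consist F"
  obtains G where "G \<in> maxCC X \<Sigma> E" "F \<subseteq> G" "extend w (vec xs F) = vec xs G"
proof -
  \<comment> \<open>Only the set of entries of this list is known. Pulling it back along
    \<open>x\<close> to \<open>vec xs {x}\<close> gives some listing \<open>ys\<close> of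
    \<open>X\<close>, and for the greedy extension any order will do.\<close>
  have "fst (singletons w) \<in> lists ((\<lambda>x. vec xs {x}) ` X)"
    using singletons_vec(2) by (simp add: lists_eq_set)
  then obtain ys where ys: "set ys \<subseteq> X" "fst (singletons w) = map (\<lambda>x. vec xs {x}) ys"
    unfolding lists_image by (auto simp: lists_eq_set)
  have "X \<subseteq> set ys"
  proof
    fix x assume x: "x \<in> X"
    then obtain y where y: "y \<in> set ys" "vec xs {x} = vec xs {y}"
      using singletons_vec(2) ys(2) by auto
    have "{x} \<in> Pow (set xs)" "{y} \<in> Pow (set xs)" using x y(1) ys(1) xs(2) by auto
    with inj_on_vec y(2) have "{x} = {y}" by (rule inj_onD)
    then show "x \<in> set ys" using y(1) by simp
  qed
  then have "set ys = X" using ys(1) by simp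
  then show thesis
    using that[of "foldl grow F ys"] foldl_grow_maxCC[OF assms] foldl_try_add_vec[OF assms(1) ys(1)]
    by (simp add: extend_def ys(2))
qed

section \<open>Which sets occur among the candidates\<close>

lemma set_combine: "set (combine f as bs) = {f a b |a b. a \<in> set as \<and> b \<in> set bs}"
  by (auto simp: combine_def set_list_bind)

lemma combine_vunion_vec:
  assumes "set L \<subseteq> vec xs ` Pow X" "set M \<subseteq> vec xs ` Pow X"
  shows "set (combine vunion L M) \<subseteq> vec xs ` Pow X"
  using assms by (fastforce simp: set_combine vunion_vec)

lemma combine_vinter_vec:
  assumes "set L \<subseteq> vec xs ` Pow X" "set M \<subseteq> vec xs ` Pow X"
  shows "set (combine vinter L M) \<subseteq> vec xs ` Pow X"
  using assms by (fastforce simp: set_combine vinter_vec)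

lemma candidates_vec:
  assumes "set S \<subseteq> vec xs ` Pow X"
  shows "set (candidates m w S) \<subseteq> vec xs ` Pow X"
proof -
  have I: "set (((\<lambda>L. combine vinter L S) ^^ n) [fst w]) \<subseteq> vec xs ` Pow X" for n
    by (induction n) (simp_all add: w_def combine_vinter_vec[OF _ assms])
  have M: "set (snd (singletons w) # fst (singletons w)) \<subseteq> vec xs ` Pow X"
    by (auto simp: singletons_vec)
  have "set (((\<lambda>L. combine vunion L (snd (singletons w) # fst (singletons w))) ^^ n)
      (snd (singletons w) # ((\<lambda>L. combine vinter L S) ^^ m) [fst w])) \<subseteq> vec xs ` Pow X" for n
  proof (induction n)
    case 0
    show ?case using I[of m] by (auto simp: singletons_vec)
  next
    case (Suc n)
    show ?case using combine_vunion_vec[OF Suc M] by simp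
  qed
  then show ?thesis unfolding candidates_def .
qed

text \<open>Each round contributes one element of \<open>W\<close>; when none is left, it adds the
  empty vector. So \<open>n\<close> only has to bound \<open>card W\<close>.\<close>

lemma union_candidate:
  assumes "vec xs I \<in> set L" "W \<subseteq> X" "card W \<le> n"
  shows "vec xs (I \<union> W) \<in> set (((\<lambda>L. combine vunion L (snd (singletons w) # fst (singletons w))) ^^ n) L)"
  using assms(2,3)
proof (induction n arbitrary: W)
  case 0
  then have "W = {}" using finite_subset[OF _ finite_X] by auto
  then show ?case using assms(1) by simp
next
  case (Suc n)
  show ?case
  proof (cases "W = {}")
    case True
    then have "vec xs (I \<union> {}) \<in> set (((\<lambda>L. combine vunion L (snd (singletons w) # fst (singletons w))) ^^ n) L)"
      by (intro Suc.IH) simp_all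
    then have "vunion (vec xs (I \<union> {})) (vec xs {}) \<in>
        set (((\<lambda>L. combine vunion L (snd (singletons w) # fst (singletons w))) ^^ Suc n) L)"
      unfolding funpow.simps comp_def set_combine using singletons_vec(1) by auto
    then show ?thesis using True by (simp add: vunion_vec)
  next
    case False
    then obtain x where x: "x \<in> W" by blast
    have fin: "finite W" using Suc.prems(1) finite_X by (rule finite_subset)
    have "vec xs (I \<union> (W - {x})) \<in> set (((\<lambda>L. combine vunion L (snd (singletons w) # fst (singletons w))) ^^ n) L)"
      by (rule Suc.IH) (use Suc.prems x fin in auto)
    moreover have "vec xs {x} \<in> set (fst (singletons w))"
      using x Suc.prems(1) singletons_vec(2) by blast
    ultimately have "vunion (vec xs (I \<union> (W - {x}))) (vec xs {x}) \<in>
        set (((\<lambda>L. combine vunion L (snd (singletons w) # fst (singletons w))) ^^ Suc n) L)"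
      unfolding funpow.simps comp_def set_combine by auto
    moreover have "I \<union> (W - {x}) \<union> {x} = I \<union> W" using x by blast
    ultimately show ?thesis by (simp add: vunion_vec)
  qed
qed

text \<open>Each round intersects with one member of \<open>S\<close> and there is no idle choice,
  so exactly \<open>card W\<close> rounds are counted. This matches the equation for
  \<open>card W\<close> in the second case of \<open>uncovered_witness\<close>.\<close>

lemma inter_candidate:
  assumes "finite W" "(\<lambda>x. vec xs (G x)) ` W \<subseteq> set S"
  shows "vec xs (X \<inter> (\<Inter>x \<in> W. G x)) \<in> set (((\<lambda>L. combine vinter L S) ^^ card W) [fst w])"
  using assms
proof (induction W rule: finite_induct)
  case empty
  then show ?case by (simp add: w_def)
next
  case (insert x W)
  have "vinter (vec xs (X \<inter> (\<Inter>x \<in> W. G x))) (vec xs (G x)) \<in>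
      set (((\<lambda>L. combine vinter L S) ^^ Suc (card W)) [fst w])"
    unfolding funpow.simps comp_def set_combine using insert by auto
  moreover have "X \<inter> (\<Inter>x \<in> W. G x) \<inter> G x = X \<inter> (\<Inter>x \<in> insert x W. G x)" by blast
  ultimately show ?case using insert.hyps by (simp add: vinter_vec)
qed

section \<open>Soundness and completeness of the search\<close>

abbreviation solutions :: "bool list set" where
  "solutions \<equiv> vec xs ` maxCC X \<Sigma> E"

lemma solutions_vec:
  assumes "set S \<subseteq> solutions"
  obtains \<S> where "\<S> \<subseteq> maxCC X \<Sigma> E" "set S = vec xs ` \<S>"
  using assms by (meson subset_imageE)

lemma maxCC_Pow: "maxCC X \<Sigma> E \<subseteq> Pow X"
  using maxCC_D(1) by blast

lemma uncovered_vec: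
  assumes "\<S> \<subseteq> maxCC X \<Sigma> E" "set S = vec xs ` \<S>" "Y \<subseteq> X"
  shows "list_all (\<lambda>F. \<not> vsubset (vec xs Y) F) S \<longleftrightarrow> uncovered \<S> Y"
  using assms(3) by (simp add: list_all_iff assms(2) vsubset_vec xs(2) uncovered_def)

text \<open>The extension contains an uncovered set and so is none of the known solutions;
  injectivity of \<open>vec xs\<close> carries this over from sets to vectors.\<close>

lemma search_sound:
  assumes S: "set S \<subseteq> solutions"
  shows "set (search m w S) \<subseteq> solutions - set S"
proof
  fix v assume "v \<in> set (search m w S)"
  then obtain u where u: "u \<in> set (candidates m w S)" "consistent w u"
    "list_all (\<lambda>F. \<not> vsubset u F) S" "v = extend w u"
    by (auto simp: search_def set_list_bind split: if_splits)
  obtain \<S> where \<S>: "\<S> \<subseteq> maxCC X \<Sigma> E" "set S = vec xs ` \<S>"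
    using S by (rule solutions_vec)
  have "set S \<subseteq> vec xs ` Pow X" using S maxCC_Pow by blast
  then obtain Y where Y: "Y \<subseteq> X" "u = vec xs Y"
    using candidates_vec[of S m] u(1) by blast
  have c: "consist Y" using u(2) consistent_vec[OF Y(1)] Y(2) by simp
  obtain G where G: "G \<in> maxCC X \<Sigma> E" "Y \<subseteq> G" "extend w (vec xs Y) = vec xs G"
    by (rule extend_vec[OF Y(1) c])
  have "uncovered \<S> Y" using u(3) uncovered_vec[OF \<S> Y(1)] Y(2) by simp
  then have "G \<notin> \<S>" using G(2) unfolding uncovered_def by blast
  then have "vec xs G \<notin> set S"
    using inj_on_image_mem_iff[OF inj_on_vec, of G xs \<S>] maxCC_Pow G(1) \<S> xs(2) by auto
  then show "v \<in> solutions - set S" using G u(4) Y(2) by simp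
qed

lemma search_complete:
  assumes S: "set S \<subseteq> solutions" and "search (2 * k + 1) w S = []"
  shows "solutions \<subseteq> set S"
proof (rule ccontr)
  let ?m = "2 * k + 1"
  assume "\<not> solutions \<subseteq> set S"
  obtain \<S> where \<S>: "\<S> \<subseteq> maxCC X \<Sigma> E" "set S = vec xs ` \<S>"
    using S by (rule solutions_vec)
  obtain F where F: "F \<in> maxCC X \<Sigma> E" "F \<notin> \<S>"
    using \<open>\<not> solutions \<subseteq> set S\<close> \<S>(2) by blast
  \<comment> \<open>By maximality no solution is contained in another one, so a missing solution is
    uncovered.\<close>
  have unc: "uncovered \<S> F"
    unfolding uncovered_def using maxCC_subset_eq[OF F(1)] F(2) \<S>(1) by blast
  have none: False if Y: "vec xs Y \<in> set (candidates ?m w S)" "Y \<subseteq> X" "consist Y" "uncovered \<S> Y" for Y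
  proof -
    have "extend w (vec xs Y) \<in> set (search ?m w S)"
      using Y(1,3,4) consistent_vec[OF Y(2)] uncovered_vec[OF \<S> Y(2)]
      unfolding search_def set_list_bind by auto
    then show False using assms(2) by simp
  qed
  have "consist G" if "G \<in> \<S>" for G using that \<S>(1) maxCC_D(2) by blast
  then show False
  proof (rule uncovered_witness[OF _ maxCC_D[OF F(1)] unc])
    fix W assume W: "W \<subseteq> X" "card W \<le> ?m" "consist W" "uncovered \<S> W"
    \<comment> \<open>The first kind of witness arises from the empty vector at the head of the
      start list.\<close>
    have "vec xs ({} \<union> W) \<in> set (candidates ?m w S)"
      unfolding candidates_def by (rule union_candidate[OF _ W(1,2)]) (simp add: singletons_vec)
    then show False using none[of W] W by simp
  next
    fix W G assume W: "W \<subseteq> X" "card W = ?m" "G ` W \<subseteq> \<S>"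
      "consist (X \<inter> (\<Inter>w \<in> W. G w) \<union> W)" "uncovered \<S> (X \<inter> (\<Inter>w \<in> W. G w) \<union> W)"
    \<comment> \<open>The second kind arises from an intersection of known solutions, to which
      \<open>W\<close> is then added.\<close>
    have "vec xs (X \<inter> (\<Inter>w \<in> W. G w)) \<in> set (((\<lambda>L. combine vinter L S) ^^ card W) [fst w])"
      by (rule inter_candidate) (use W(1,3) \<S>(2) finite_subset[OF _ finite_X] in auto)
    then have "vec xs (X \<inter> (\<Inter>w \<in> W. G w) \<union> W) \<in> set (candidates ?m w S)"
      unfolding candidates_def by (intro union_candidate W(1)) (simp_all add: W(2))
    then show False using none[of "X \<inter> (\<Inter>w \<in> W. G w) \<union> W"] W by blast
  qed
qed

end

section \<open>The enumeration loop\<close>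

text \<open>
  Stopping must not take longer than a polynomial in the input alone, whereas finding out that no
  solution is left takes time depending on the number of solutions. Hence every solution is held
  back until the search for the next one has ended.
\<close>

lemma incremental_polynomial_timeI:
  fixes search :: "'a::encodable \<Rightarrow> 'b::encodable list \<Rightarrow> 'b list"
  assumes search: "ptime (\<lambda>z. search (fst z) (snd z))"
    and P: "\<And>w R. (w, R) \<in> P \<Longrightarrow> \<exists>x Q. w = encode x \<and> R = encode ` Q \<and> finite Q \<and> inj_on encode Q \<and>
      (\<forall>y \<in> Q. esize y \<le> esize x) \<and>
      (\<forall>S. set S \<subseteq> Q \<longrightarrow> set (search x S) \<subseteq> Q - set S \<and> (search x S = [] \<longrightarrow> Q \<subseteq> set S))"
  shows "incremental_polynomial_time P"
proof -
  \<comment> \<open>The state consists of the input, the solutions taken so far and the search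
    result for exactly these. A step takes the head of that result and searches again, so the
    outcome of the new search is known when the head is emitted.\<close>
  let ?init = "\<lambda>x. (x, [] :: 'b list, search x [])"
  let ?step = "\<lambda>z. case snd (snd z) of [] \<Rightarrow> z | y # ys \<Rightarrow> (fst z, y # fst (snd z), search (fst z) (y # fst (snd z)))"
  have "ptime ?init"
    by (intro ptime_intros ptime_comp2[OF search])
  then obtain c0 T0 where c0: "computes c0 ?init T0" and T0: "poly_bounded T0"
    by (rule ptimeE)
  obtain p0 where p0: "\<And>x. T0 x \<le> poly p0 (esize x)"
    using T0 unfolding poly_bounded_def by blast
  have "ptime ?step"
    by (intro ptime_intros ptime_comp2[OF search])
  then obtain c1 T1 where c1: "computes c1 ?step T1" and T1: "poly_bounded T1"
    by (rule ptimeE)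
  obtain p1 where p1: "\<And>z. T1 z \<le> poly p1 (esize z)"
    using T1 unfolding poly_bounded_def by blast
  obtain q where q: "\<And>z. esize (search (fst z) (snd z)) \<le> poly q (esize z)"
    using ptime_poly_bounded[OF search] unfolding poly_bounded_def by blast
  \<comment> \<open>With \<open>N = esize x + length S\<close>, the value of \<open>a\<close> bounds
    the size of \<open>(x, S)\<close>, and that of \<open>b\<close> the size of the whole state. In
    \<open>d\<close>, the first summand pays for the step, \<open>N\<close> for writing the solution
    and 20 for the constant costs.\<close>
  define a :: "nat poly" where "a = [:2, 2, 1:]"
  define b where "b = 1 + a + pcompose q a"
  define d where "d = pcompose p1 b + [:20, 1:]"
  let ?loop = "While (Tl (Tl (Var 0))) (Seq c1 (Emit (Hd (Hd (Tl (Var 0))))))"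

  \<comment> \<open>Adding \<open>length S\<close> to the output index counts the earlier outputs,
    so that the bounds fit together along the induction. After the last output only the failing test
    is left, which takes 4 units.\<close>
  have loop: "\<exists>s' T out. exec ?loop (s, t, os) (s', T, os @ out) \<and>
      distinct (map snd out) \<and> set (map snd out) = encode ` (Q - set S) \<and>
      (\<forall>i < length out. map fst out ! i \<le> (t # map fst out) ! i + poly d (esize x + length S + i)) \<and>
      T \<le> last (t # map fst out) + 4"
    if fin: "finite Q" and inj: "inj_on encode Q" and size: "\<forall>y \<in> Q. esize y \<le> esize x"
      and sound: "\<forall>S. set S \<subseteq> Q \<longrightarrow> set (search x S) \<subseteq> Q - set S \<and> (search x S = [] \<longrightarrow> Q \<subseteq> set S)"
      and S: "set S \<subseteq> Q" and s: "s 0 = encode (x, S, search x S)"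
    for Q x S s t os
    using S s
  proof (induction "card (Q - set S)" arbitrary: S s t os rule: less_induct)
    case less
    show ?case
    proof (cases "search x S")
      case Nil
      have "exec ?loop (s, t, os) (s, Suc (t + expr_cost (Tl (Tl (Var 0)))), os)"
        by (rule exec.WhileFalse) (simp add: less.prems(2) Nil)
      moreover have "Q - set S = {}" using sound less.prems(1) Nil by simp
      ultimately show ?thesis
        by (intro exI[of _ s] exI[of _ "t + 4"] exI[of _ "[]"]) (simp add: eval_nat_numeral)
    next
      case (Cons y ys)
      let ?S = "y # S"
      have "set (search x S) \<subseteq> Q - set S" using sound less.prems(1) by simp
      then have y: "y \<in> Q" "y \<notin> set S" using Cons by auto
      let ?z = "(x, S, search x S)"
      have stepz: "?step ?z = (x, ?S, search x ?S)" by (simp add: Cons)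
      obtain s1 t1 where 1: "exec c1 (s, t + 4, os) (s1, t1, os)" "s1 0 = encode (?step ?z)"
        "t1 \<le> t + 4 + T1 ?z"
        by (rule computesE[where s = s, OF c1 less.prems(2)])
      have s1: "s1 0 = encode (x, ?S, search x ?S)" using 1(2) unfolding stepz .
      let ?t = "t1 + 5 + esize y"
      have e: "exec (Emit (Hd (Hd (Tl (Var 0))))) (s1, t1, os) (s1, ?t, os @ [(?t, encode y)])"
        using exec.Emit[of ?t t1 "Hd (Hd (Tl (Var 0)))" s1 os] s1 by simp
      have "card (Q - set ?S) < card (Q - set S)"
        using fin y by (intro psubset_card_mono) auto
      moreover have "set ?S \<subseteq> Q" using y less.prems(1) by simp
      ultimately have "\<exists>s' T out. exec ?loop (s1, ?t, os @ [(?t, encode y)]) (s', T, (os @ [(?t, encode y)]) @ out) \<and>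
        distinct (map snd out) \<and> set (map snd out) = encode ` (Q - set ?S) \<and>
        (\<forall>i < length out. map fst out ! i \<le> (?t # map fst out) ! i + poly d (esize x + length ?S + i)) \<and>
        T \<le> last (?t # map fst out) + 4"
        using s1 by (rule less.hyps)
      then obtain s2 T out where 2: "exec ?loop (s1, ?t, os @ [(?t, encode y)]) (s2, T, (os @ [(?t, encode y)]) @ out)"
        "distinct (map snd out)" "set (map snd out) = encode ` (Q - set ?S)"
        "\<forall>i < length out. map fst out ! i \<le> (?t # map fst out) ! i + poly d (esize x + length ?S + i)"
        "T \<le> last (?t # map fst out) + 4"
        by (elim exE conjE)
      have "exec ?loop (s, t, os) (s2, T, os @ (?t, encode y) # out)"
      proof (rule exec.WhileTrue)
        show "eval_expr (Tl (Tl (Var 0))) s \<noteq> Leaf" by (simp add: less.prems(2) Cons)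
        show "exec (Seq c1 (Emit (Hd (Hd (Tl (Var 0)))))) (s, Suc (t + expr_cost (Tl (Tl (Var 0)))), os)
            (s1, ?t, os @ [(?t, encode y)])"
          by (rule exec.Seq[OF _ e]) (use 1(1) in \<open>simp add: eval_nat_numeral\<close>)
        show "exec ?loop (s1, ?t, os @ [(?t, encode y)]) (s2, T, os @ (?t, encode y) # out)"
          using 2(1) by simp
      qed
      moreover have "distinct (map snd ((?t, encode y) # out))"
        using 2(2,3) y inj_on_image_mem_iff[OF inj, of y "Q - set ?S"] by (simp add: image_iff)
      moreover have "set (map snd ((?t, encode y) # out)) = encode ` (Q - set S)"
      proof -
        have "Q - set S = insert y (Q - set ?S)" using y by auto
        then show ?thesis using 2(3) by simp
      qed
      moreover have "\<forall>i < length ((?t, encode y) # out). map fst ((?t, encode y) # out) ! i \<le>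
          (t # map fst ((?t, encode y) # out)) ! i + poly d (esize x + length S + i)"
      proof (intro allI impI)
        fix i assume i: "i < length ((?t, encode y) # out)"
        show "map fst ((?t, encode y) # out) ! i \<le>
          (t # map fst ((?t, encode y) # out)) ! i + poly d (esize x + length S + i)"
        proof (cases i)
          case 0
          let ?N = "esize x + length S"
          have "esize S \<le> length S * Suc (esize x) + 1"
            by (rule esize_list_le) (use size less.prems(1) in auto)
          then have "esize (x, S) \<le> 2 + esize x + length S * Suc (esize x)" by simp
          also have "\<dots> \<le> poly a ?N"
            by (simp add: a_def algebra_simps)
          finally have xS: "esize (x, S) \<le> poly a ?N" .
          have "esize (search x S) \<le> poly q (esize (x, S))" using q[of "(x, S)"] by simp
          also have "\<dots> \<le> poly q (poly a ?N)" by (rule poly_nat_mono[OF xS])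
          finally have "esize ?z \<le> poly b ?N" using xS by (simp add: b_def poly_pcompose)
          then have "poly p1 (esize ?z) \<le> poly p1 (poly b ?N)" by (rule poly_nat_mono)
          then have "T1 ?z \<le> poly p1 (poly b ?N)" using p1[of ?z] by (rule le_trans[rotated])
          moreover have "esize y \<le> esize x" using size y(1) by simp
          ultimately have "?t \<le> t + (poly p1 (poly b ?N) + 20 + ?N)" using 1(3) by linarith
          also have "poly p1 (poly b ?N) + 20 + ?N = poly d ?N" by (simp add: d_def poly_pcompose)
          finally show ?thesis using 0 by simp
        next
          \<comment> \<open>Output \<open>j\<close> of the remaining run is output
            \<open>Suc j\<close> here, and the index shift is balanced by
            \<open>length ?S = Suc (length S)\<close>.\<close>
          case (Suc j)
          then show ?thesis using 2(4) i by simp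
        qed
      qed
      moreover have "T \<le> last (t # map fst ((?t, encode y) # out)) + 4"
        using 2(5) by simp
      ultimately show ?thesis by (intro exI conjI)
    qed
  qed

  show ?thesis
    unfolding incremental_polynomial_time_def
  \<comment> \<open>\<open>p0\<close> pays for the initial search, which precedes the first output,
    or halting if there is none; \<open>d\<close> is at least 4 and thus covers the final
    test.\<close>
  proof (intro exI[of _ "Seq c0 ?loop"] exI[of _ "p0 + d"] ballI)
    fix z assume "z \<in> P"
    obtain w R where z: "z = (w, R)" by (cases z)
    from P[OF \<open>z \<in> P\<close>[unfolded z]] obtain x Q where w: "w = encode x" and R: "R = encode ` Q"
      and Q: "finite Q" "inj_on encode Q" "\<forall>y \<in> Q. esize y \<le> esize x"
        "\<forall>S. set S \<subseteq> Q \<longrightarrow> set (search x S) \<subseteq> Q - set S \<and> (search x S = [] \<longrightarrow> Q \<subseteq> set S)"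
      by (elim exE conjE)
    let ?s = "(\<lambda>_. Leaf)(0 := w)"
    have "?s 0 = encode x" using w by simp
    then obtain s1 t1 where 1: "exec c0 (?s, 0, []) (s1, t1, [])" "s1 0 = encode (?init x)" "t1 \<le> 0 + T0 x"
      by (rule computesE[where s = ?s, OF c0])
    have "\<exists>s' T out. exec ?loop (s1, t1, []) (s', T, [] @ out) \<and>
      distinct (map snd out) \<and> set (map snd out) = encode ` (Q - set []) \<and>
      (\<forall>i < length out. map fst out ! i \<le> (t1 # map fst out) ! i + poly d (esize x + length ([] :: 'b list) + i)) \<and>
      T \<le> last (t1 # map fst out) + 4"
      by (rule loop[where s = s1 and S = "[]", OF Q _ 1(2)]) simp
    then obtain s2 T out where 2: "exec ?loop (s1, t1, []) (s2, T, out)" "distinct (map snd out)"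
      "set (map snd out) = R"
      "\<And>i. i < length out \<Longrightarrow> map fst out ! i \<le> (t1 # map fst out) ! i + poly d (esize x + i)"
      "T \<le> last (t1 # map fst out) + 4"
      by (auto simp: R)
    have t1: "t1 \<le> poly p0 (esize x)" using 1(3) p0[of x] by simp
    have d: "4 \<le> poly d (esize x)" by (simp add: d_def)
    have "incremental_delays (p0 + d) (tree_size w) (map fst out) T"
      unfolding incremental_delays_def
    proof (intro conjI allI impI)
      fix i assume i: "i < length (map fst out)"
      show "map fst out ! i \<le> (0 # map fst out) ! i + poly (p0 + d) (tree_size w + i)"
        using 2(4)[of i] i t1 by (cases i) (auto simp: w)
    next
      show "T \<le> last (0 # map fst out) + poly (p0 + d) (tree_size w)"
        using 2(5) t1 d by (cases "out = []") (auto simp: w)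
    qed
    moreover have "exec (Seq c0 ?loop) (initial_config w) (s2, T, out)"
      unfolding initial_config_def by (rule exec.Seq[OF 1(1) 2(1)])
    ultimately show "case z of (w, R) \<Rightarrow> \<exists>s T os. exec (Seq c0 ?loop) (initial_config w) (s, T, os) \<and>
        distinct (map snd os) \<and> set (map snd os) = R \<and>
        incremental_delays (p0 + d) (tree_size w) (map fst os) T"
      unfolding z prod.case using 2(2,3) by (intro exI conjI)
  qed
qed

section \<open>Injectivity and size of the codes, and the final assembly\<close>

lemma inj_encode_bool_list: "inj (encode :: bool list \<Rightarrow> tree)"
proof (rule injI)
  fix u v :: "bool list"
  assume "encode u = encode v"
  then show "u = v"
  proof (induction u arbitrary: v)
    case Nil
    then show ?case by (cases v) simp_all
  next
    case (Cons a u)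
    then obtain b v' where v: "v = b # v'" by (cases v) simp_all
    have "a = b" using Cons.prems v by (cases a; cases b) simp_all
    then show ?case using Cons v by simp
  qed
qed

text \<open>The code of \<open>True\<close> is larger than that of \<open>False\<close>, so the full
  set has the largest vector. As this vector is part of the input, no solution is larger than the
  input.\<close>

lemma esize_vec_le: "esize (vec xs A) \<le> esize (vec xs (set xs))"
proof -
  have "esize (vec xs A) \<le> 4 * length xs + 1"
    using esize_bool_list_le[of "vec xs A"] by simp
  also have "\<dots> = esize (replicate (length xs) True)"
    by (induction xs) simp_all
  also have "replicate (length xs) True = vec xs (set xs)"
    by (simp add: vec_def map_replicate_const[symmetric] cong: map_cong)
  finally show ?thesis .
qed

theorem theorem3:
  fixes k :: nat
  shows "incremental_polynomial_time
    (MCCEnum (\<lambda>X \<Sigma> E. caratheodory_number X (closed_sets X \<Sigma>) \<le> k))"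
proof (rule incremental_polynomial_timeI)
  \<comment> \<open>The number \<open>2 * k + 1\<close> is fixed by \<open>k\<close> alone, so one
    program serves all inputs.\<close>
  show "ptime (\<lambda>z. search (2 * k + 1) (fst z) (snd z))"
    by (intro ptime_intros)
  fix w R
  assume "(w, R) \<in> MCCEnum (\<lambda>X \<Sigma> E. caratheodory_number X (closed_sets X \<Sigma>) \<le> k)"
  then obtain X \<Sigma> E ims es and xs :: "nat list" where wR: "(w, R) = (code_input xs ims es, code_set xs ` maxCC X \<Sigma> E)"
    and inst: "finite X" "implicational_base X \<Sigma>" "simple_graph X E" "E \<noteq> {}"
      "caratheodory_number X (closed_sets X \<Sigma>) \<le> k" "distinct xs" "set xs = X"
      "distinct ims" "set ims = \<Sigma>" "distinct es" "set es = E"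
    unfolding MCCEnum_def mem_Collect_eq by (elim exE conjE)
  have w: "w = code_input xs ims es" and R: "R = code_set xs ` maxCC X \<Sigma> E"
    using wR by simp_all
  interpret coded_instance X \<Sigma> E k xs ims es
    by unfold_locales (rule inst)+
  let ?w = "coded_instance.w X xs ims es"
  have "finite (maxCC X \<Sigma> E)" using maxCC_Pow inst(1) by (meson finite_Pow_iff finite_subset)
  moreover have "esize v \<le> esize ?w" if "v \<in> solutions" for v
  proof -
    from that obtain F where "v = vec xs F" by blast
    then have "esize v \<le> esize (vec xs X)" using esize_vec_le[of xs F] inst(7) by simp
    also have "\<dots> \<le> esize ?w" by (simp add: w_def)
    finally show ?thesis .
  qed
  moreover have "R = encode ` solutions" unfolding R image_image encode_vec ..
  ultimately show "\<exists>x Q. w = encode x \<and> R = encode ` Q \<and> finite Q \<and> inj_on encode Q \<and>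
      (\<forall>y \<in> Q. esize y \<le> esize x) \<and>
      (\<forall>S. set S \<subseteq> Q \<longrightarrow> set (search (2 * k + 1) x S) \<subseteq> Q - set S \<and>
        (search (2 * k + 1) x S = [] \<longrightarrow> Q \<subseteq> set S))"
    using search_sound search_complete encode_w w inj_on_subset[OF inj_encode_bool_list subset_UNIV]
    by (intro exI[of _ ?w] exI[of _ solutions]) auto
qed

end
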